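(* There exist an integer $n_0$ and absolute constants $c>0$ and $C>0$ such that for every finite set $A$ of positive real numbers with $|A|\geq n_0$, $$|AA+A| \geq C\,|A|^{\frac{3}{2}+c},$$ where $AA+A=\{ab+c : a,b,c\in A\}$.
   Context: For a finite set $A\subset\mathbb{R}$, $AA+A:=\{ab+c: a,b,c\in A\}$ and $|\cdot|$ denotes cardinality. The paper writes the conclusion as $|AA+A|\gg |A|^{3/2+c}$, where $X\gg Y$ means $X\geq CY$ for an absolute constant $C>0$. *)

theory Defs
  imports Complex_Main
begin

definition AA_plus_A :: "real set \<Rightarrow> real set" where
  "AA_plus_A A = {a * b + c | a b c. a \<in> A \<and> b \<in> A \<and> c \<in> A}"

end

theory Submission
  imports Defs "HOL-Analysis.Convex"
begin

text \<open>
  Put $n = |A|$ and $S = AA + A$. Points of $A \times A$ lie on rays of slope $l = b/a$. If $(v, lv)$ and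
  $(x, mx)$ are points of $A \times A$ and $c \in A$, then $c (v, lv) + (x, mx)$ lies in $S \times S$, in the
  cone spanned by the slopes $l$ and $m$. Using only consecutive slopes, the cones are disjoint and one gets
  $|S|^2 \geq n \cdot n^2$ (Solymosi's argument). To gain a factor $M = n^\epsilon$, cut the slopes into
  blocks of consecutive ones, use all pairs $(l, m)$ inside a block, and bound the number of coincidences
  among the sums. Three kinds of slopes are treated, one of which carries a third of $A \times A$.

  If the rays carry fewer than $\sqrt n / M$ points, blocks of $\sqrt n$ slopes work: two sums with
  different $l$ are determined by the two summands from $A \times A$, and a coincidence
  with the same $l$ forces the difference of these summands to be parallel to $l$, which happens for at most
  one $l$. If $|A \cdot A_l| > Mn$, where $A_l$ is the set of abscissae on the ray, then $A \cdot A_l$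
  replaces $A$ in Solymosi's argument. In the remaining case blocks of size $2M$ suffice, because
  $A$ is almost stable under multiplication by the large set $A_m$: many coincidences would produce too many
  rich lines in a grid. For the coincidences with equal $l$, which say that $A$ has many popular
  differences $\eta x$ with $x \in A_m$, also the differences $\eta (x - x')$ are popular, and
  multiplying by $A_m$ gives lines with slopes $w/u$ and intercepts $w \eta (x - x')$; these are too many
  since $w (x - x') = w' (y - y')$ has few solutions.
\<close>

section \<open>Rich lines in grids\<close>

text \<open>Cauchy-Schwarz over the fibres: coincidences are counted by the sum of the squared fibre
  sizes. An upper bound for coincidences thus becomes a lower bound for an image.\<close>

lemma card_square_le_collisions:
  fixes F :: "'a \<Rightarrow> 'b"
  assumes "finite J"
  shows "(real (card J))\<^sup>2 \<le> real (card (F ` J)) * real (card {(i, j). i \<in> J \<and> j \<in> J \<and> F i = F j})"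
proof -
  define fib where "fib y = {i \<in> J. F i = y}" for y
  have fin: "finite (fib y)" for y using assms by (simp add: fib_def)
  have J: "card J = (\<Sum>y\<in>F ` J. card (fib y))"
    unfolding fib_def using sum.image_gen[OF assms, of "\<lambda>_. 1::nat" F] by simp
  have "{(i, j). i \<in> J \<and> j \<in> J \<and> F i = F j} = (\<Union>y\<in>F ` J. fib y \<times> fib y)"
    by (auto simp: fib_def)
  then have "card {(i, j). i \<in> J \<and> j \<in> J \<and> F i = F j} = card (\<Union>y\<in>F ` J. fib y \<times> fib y)"
    by simp
  also have "\<dots> = (\<Sum>y\<in>F ` J. card (fib y \<times> fib y))"
    by (rule card_UN_disjoint) (use assms fin in \<open>auto simp: fib_def\<close>)
  finally have E: "real (card {(i, j). i \<in> J \<and> j \<in> J \<and> F i = F j}) = (\<Sum>y\<in>F ` J. (real (card (fib y)))\<^sup>2)"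
    by (simp add: card_cartesian_product power2_eq_square)
  have "(\<Sum>y\<in>F ` J. real (card (fib y)))\<^sup>2 \<le> (\<Sum>y\<in>F ` J. (real (card (fib y)))\<^sup>2) * card (F ` J)"
    by (rule sum_squared_le_sum_of_squares) 
  then show ?thesis using J E by (simp add: mult.commute)
qed

text \<open>A point left out of the set on the right is the largest of its fibre in
  \<open>T\<close>, and \<open>f\<close> is injective on such points.\<close>

lemma card_non_last_in_fibre:
  fixes f :: "real \<Rightarrow> 'b"
  assumes "finite T" "finite C" "f ` T \<subseteq> C"
  shows "card T \<le> card {t \<in> T. \<exists>t'\<in>T. t < t' \<and> f t = f t'} + card C"
proof -
  let ?G = "{t \<in> T. \<exists>t'\<in>T. t < t' \<and> f t = f t'}"
  have "inj_on f (T - ?G)"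
  proof (rule inj_onI)
    fix x y assume "x \<in> T - ?G" "y \<in> T - ?G" "f x = f y"
    then show "x = y" by (cases x y rule: linorder_cases) auto
  qed
  then have "card (T - ?G) \<le> card C"
    by (rule card_inj_on_le) (use assms in auto)
  moreover have "card T = card (T - ?G) + card ?G"
    using assms by (subst card_Diff_subset) (auto simp: card_mono)
  ultimately show ?thesis by simp
qed

section \<open>Cutting a finite set into blocks of consecutive elements\<close>

definition rnk :: "real set \<Rightarrow> real \<Rightarrow> nat" where
  "rnk X t = card {u \<in> X. u < t}"

lemma rnk_mono: "finite X \<Longrightarrow> t \<le> t' \<Longrightarrow> rnk X t \<le> rnk X t'"
  unfolding rnk_def by (intro card_mono) auto

lemma rnk_strict_mono: "finite X \<Longrightarrow> t \<in> X \<Longrightarrow> t < t' \<Longrightarrow> rnk X t < rnk X t'"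
  unfolding rnk_def by (intro psubset_card_mono) auto

lemma rnk_inj: "finite X \<Longrightarrow> inj_on (rnk X) X"
  by (rule inj_onI) (metis linorder_neqE_linordered_idom nat_neq_iff rnk_strict_mono)

lemma rnk_less: "finite X \<Longrightarrow> t \<in> X \<Longrightarrow> rnk X t < card X"
  unfolding rnk_def by (intro psubset_card_mono) auto

lemma card_same_block:
  assumes "finite X" "g > 0"
  shows "card {t \<in> X. rnk X t div g = i} \<le> g"
proof -
  have "card {t \<in> X. rnk X t div g = i} \<le> card {i * g..<i * g + g}"
  proof (rule card_inj_on_le)
    show "inj_on (rnk X) {t \<in> X. rnk X t div g = i}"
      using rnk_inj[OF assms(1)] by (rule inj_on_subset) auto
    show "rnk X ` {t \<in> X. rnk X t div g = i} \<subseteq> {i * g..<i * g + g}"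
    proof
      fix r assume "r \<in> rnk X ` {t \<in> X. rnk X t div g = i}"
      then have "r div g = i" by auto
      then have "r = i * g + r mod g" by (metis div_mult_mod_eq)
      moreover have "r mod g < g" using assms(2) by simp
      ultimately show "r \<in> {i * g..<i * g + g}" unfolding atLeastLessThan_iff by linarith
    qed
  qed simp
  then show ?thesis by simp
qed

text \<open>The block length is 8x/k rounded up. Rounding adds at most 1, which is at most x/k;
  hence 9 in place of 8.\<close>

lemma block_size:
  fixes k :: real
  assumes "8 \<le> k" "k \<le> real x"
  obtains g :: nat where "g > 0" "real g \<le> 9 * real x / k" "\<And>r. r < x \<Longrightarrow> real (r div g) \<le> k / 8"
proof
  define q where "q = real x / k"
  let ?g = "nat \<lceil>8 * q\<rceil>"
  have q1: "1 \<le> q" and xq: "real x = k * q" using assms by (auto simp: q_def field_simps)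
  have gl: "8 * q \<le> real ?g" "real ?g \<le> 8 * q + 1" using q1 by linarith+
  then show g0: "?g > 0" using q1 by linarith
  have "9 * real x / k = 9 * q" by (simp add: q_def)
  then show "real ?g \<le> 9 * real x / k" using gl q1 by linarith
  fix r assume "r < x"
  have "real (r div ?g) \<le> real r / real ?g" by (rule of_nat_div_le_of_nat)
  also have "\<dots> \<le> real x / real ?g" using \<open>r < x\<close> g0 by (intro divide_right_mono) auto
  also have "\<dots> \<le> real x / (8 * q)"
    using gl q1 g0 by (intro divide_left_mono mult_pos_pos) auto
  also have "\<dots> = k / 8" using q1 xq by simp
  finally show "real (r div ?g) \<le> k / 8" .
qed

text \<open>
  The Szemeredi--Trotter bound for grids has a direct proof: cut the grid into about $k/8 \times k/8$
  cells. A line is monotone, so it meets at most $k/2$ cells, and half of its points share a cell with a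
  later one; but two points determine the line.
\<close>

lemma rich_lines:
  fixes X Y :: "real set" and L :: "(real \<times> real) set" and k :: real
  assumes X: "finite X" and Y: "finite Y" and L: "finite L" and k: "8 \<le> k"
    and rich: "\<And>s b. (s, b) \<in> L \<Longrightarrow> s \<noteq> 0 \<and> k \<le> real (card {t \<in> X. s * t + b \<in> Y})"
  shows "real (card L) * k ^ 3 \<le> 512 * (real (card X))\<^sup>2 * (real (card Y))\<^sup>2"
proof (cases "L = {}")
  case False
  then obtain s0 b0 where l0: "(s0, b0) \<in> L" by auto
  let ?T = "\<lambda>s b. {t \<in> X. s * t + b \<in> Y}"
  have kX: "k \<le> real (card X)"
  proof -
    have "card (?T s0 b0) \<le> card X" using X by (intro card_mono) auto
    then show ?thesis using rich[OF l0] by linarith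
  qed
  have kY: "k \<le> real (card Y)"
  proof -
    have "card (?T s0 b0) \<le> card Y"
      by (rule card_inj_on_le[of "\<lambda>t. s0 * t + b0"]) (use rich[OF l0] Y in \<open>auto simp: inj_on_def\<close>)
    then show ?thesis using rich[OF l0] by linarith
  qed
  obtain g where g: "g > 0" "real g \<le> 9 * real (card X) / k"
    "\<And>r. r < card X \<Longrightarrow> real (r div g) \<le> k / 8" using block_size[OF k kX] by blast
  obtain h where h: "h > 0" "real h \<le> 9 * real (card Y) / k"
    "\<And>r. r < card Y \<Longrightarrow> real (r div h) \<le> k / 8" using block_size[OF k kY] by blast
  define ci where "ci t = rnk X t div g" for t
  define cj where "cj y = rnk Y y div h" for y
  \<comment> \<open>Pairs of grid points in a common cell: the first point is free, the second
    ranges over its cell, which has at most \<open>g * h\<close> points.\<close>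
  define Q where "Q = (SIGMA p : X \<times> Y. {t \<in> X. ci t = ci (fst p)} \<times> {y \<in> Y. cj y = cj (snd p)})"
  define R where "R l = {((t, y), (t', y')) \<in> Q. t < t' \<and> y = fst l * t + snd l \<and> y' = fst l * t' + snd l}" for l
  have finQ: "finite Q" unfolding Q_def using X Y by auto
  have "card Q = (\<Sum>p\<in>X \<times> Y. card ({t \<in> X. ci t = ci (fst p)} \<times> {y \<in> Y. cj y = cj (snd p)}))"
    unfolding Q_def using X Y by simp
  also have "\<dots> \<le> (\<Sum>p\<in>X \<times> Y. g * h)"
    unfolding card_cartesian_product ci_def cj_def
    by (intro sum_mono mult_mono card_same_block) (use X Y g h in auto)
  finally have "card Q \<le> card X * card Y * (g * h)" by (simp add: card_cartesian_product)
  then have cQ: "real (card Q) \<le> real (card X) * real (card Y) * (real g * real h)"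
    by (metis of_nat_le_iff of_nat_mult)
  \<comment> \<open>Two points with different abscissae determine the line; this is why
    \<open>R\<close> asks for \<open>t < t'\<close>.\<close>
  have disj: "R l \<inter> R l' = {}" if "l \<noteq> l'" for l l'
  proof (rule ccontr)
    assume "R l \<inter> R l' \<noteq> {}"
    then obtain t y t' y' where "t < t'" and
      e: "fst l * t + snd l = fst l' * t + snd l'" "fst l * t' + snd l = fst l' * t' + snd l'"
      unfolding R_def by auto
    from e have "(fst l - fst l') * (t - t') = 0" by (simp add: algebra_simps)
    with \<open>t < t'\<close> have "fst l = fst l'" by simp
    with e have "l = l'" by (simp add: prod_eq_iff)
    with that show False by simp
  qed
  have Rlow: "k / 2 \<le> real (card (R l))" if "l \<in> L" for l
  proof -
    obtain s b where l: "l = (s, b)" by fastforce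
    with that have sb: "(s, b) \<in> L" by simp
    note r = rich[OF sb]
    define T where "T = ?T s b"
    have fT: "finite T" unfolding T_def using X by auto
    \<comment> \<open>along the line the two cell indices are monotone, so \<open>f\<close> separates the cells met by the line\<close>
    define e :: int where "e = (if s > 0 then 1 else -1)"
    define f where "f t = int (ci t) + e * int (cj (s * t + b))" for t
    define z where "z = \<lfloor>k / 8\<rfloor>"
    define C where "C = (if s > 0 then {0..2 * z} else {-z..z})"
    have z0: "z \<ge> 0" using k unfolding z_def by simp
    have fC: "f ` T \<subseteq> C"
    proof
      fix v assume "v \<in> f ` T"
      then obtain t where t: "t \<in> X" "s * t + b \<in> Y" "v = f t" unfolding T_def by auto
      have "real (ci t) \<le> k / 8" unfolding ci_def using g(3) rnk_less[OF X t(1)] by blast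
      then have 1: "int (ci t) \<le> z" unfolding z_def by linarith
      have "real (cj (s * t + b)) \<le> k / 8" unfolding cj_def using h(3) rnk_less[OF Y t(2)] by blast
      then have 2: "int (cj (s * t + b)) \<le> z" unfolding z_def by linarith
      show "v \<in> C" unfolding C_def t f_def e_def using 1 2 by auto
    qed
    \<comment> \<open>The number of values is 2z + 1, at most k/4 + 1, which is at most k/2 since k
      is at least 8.\<close>
    have "card C = nat (2 * z + 1)" using z0 by (auto simp: C_def)
    then have cC: "real (card C) \<le> k / 2" using z0 k unfolding z_def by linarith
    let ?G = "{t \<in> T. \<exists>t'\<in>T. t < t' \<and> f t = f t'}"
    have "card T \<le> card ?G + card C"
      by (rule card_non_last_in_fibre) (use fT fC in \<open>auto simp: C_def\<close>)
    then have G: "k / 2 \<le> real (card ?G)" using r cC unfolding T_def by linarith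
    have "?G \<subseteq> (\<lambda>p. fst (fst p)) ` R l"
    proof
      fix t assume "t \<in> ?G"
      then obtain t' where t: "t \<in> T" "t' \<in> T" "t < t'" "f t = f t'" by auto
      \<comment> \<open>The column index cannot decrease, and \<open>e\<close> is chosen so that the
        signed row index cannot decrease either; equal sums then force both to stay
        constant.\<close>
      have ile: "ci t \<le> ci t'" unfolding ci_def using t by (intro div_le_mono rnk_mono X) auto
      have "ci t = ci t' \<and> cj (s * t + b) = cj (s * t' + b)"
      proof (cases "s > 0")
        case True
        then have "cj (s * t + b) \<le> cj (s * t' + b)" unfolding cj_def
          using t by (intro div_le_mono rnk_mono Y) auto
        with ile t(4) True show ?thesis unfolding f_def e_def by auto
      next
        case False
        then have "cj (s * t' + b) \<le> cj (s * t + b)" unfolding cj_def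
          using t by (intro div_le_mono rnk_mono Y) (auto intro: mult_left_mono_neg)
        with ile t(4) False show ?thesis unfolding f_def e_def by auto
      qed
      then have "((t, s * t + b), (t', s * t' + b)) \<in> R l"
        unfolding R_def Q_def l using t by (auto simp: T_def)
      then show "t \<in> (\<lambda>p. fst (fst p)) ` R l" by force
    qed
    moreover have "finite (R l)" using finQ unfolding R_def by (rule finite_subset[rotated]) auto
    ultimately have "card ?G \<le> card (R l)" by (meson surj_card_le)
    with G show ?thesis by linarith
  qed
  have "real (card L) * (k / 2) = (\<Sum>l\<in>L. k / 2)" by simp
  also have "\<dots> \<le> (\<Sum>l\<in>L. real (card (R l)))" by (intro sum_mono Rlow)
  also have "\<dots> = real (\<Sum>l\<in>L. card (R l))" by simp
  also have "(\<Sum>l\<in>L. card (R l)) = card (\<Union>l\<in>L. R l)"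
    by (rule card_UN_disjoint[symmetric]) 
       (use L finQ disj in \<open>auto intro: finite_subset[OF _ finQ] simp: R_def\<close>)
  also have "card (\<Union>l\<in>L. R l) \<le> card Q" by (rule card_mono[OF finQ]) (auto simp: R_def)
  also have "real (card Q) \<le> real (card X) * real (card Y) * (real g * real h)" by (rule cQ)
  also have "\<dots> \<le> real (card X) * real (card Y) * ((9 * real (card X) / k) * (9 * real (card Y) / k))"
    using g h k by (intro mult_left_mono mult_mono) auto
  \<comment> \<open>The factor 2k^2 turns the left side into |L| k^3. The constant obtained is 2 *
    81 = 162, relaxed to a power of two.\<close>
  finally have "real (card L) * (k / 2) * (2 * k\<^sup>2) \<le>
     (real (card X) * real (card Y) * ((9 * real (card X) / k) * (9 * real (card Y) / k))) * (2 * k\<^sup>2)"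
    using k by (intro mult_right_mono) auto
  also have "\<dots> = 162 * ((real (card X))\<^sup>2 * (real (card Y))\<^sup>2)"
    using k by (simp add: field_simps power2_eq_square)
  also have "\<dots> \<le> 512 * ((real (card X))\<^sup>2 * (real (card Y))\<^sup>2)" by (intro mult_right_mono) auto
  finally show ?thesis by (simp add: power2_eq_square power3_eq_cube mult.assoc)
qed simp

section \<open>Popular differences and linear equations\<close>

lemma sum_card_swap:
  assumes "finite A" "finite V"
  shows "(\<Sum>a\<in>A. card {x \<in> V. P a x}) = (\<Sum>x\<in>V. card {a \<in> A. P a x})"
proof -
  have "(\<Sum>a\<in>A. card {x \<in> V. P a x}) = (\<Sum>a\<in>A. \<Sum>x\<in>V. if P a x then 1 else 0)"
    using assms by (simp add: sum.If_cases Int_def)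
  also have "\<dots> = (\<Sum>x\<in>V. \<Sum>a\<in>A. if P a x then 1 else 0)" by (rule sum.swap)
  also have "\<dots> = (\<Sum>x\<in>V. card {a \<in> A. P a x})"
    using assms by (simp add: sum.If_cases Int_def)
  finally show ?thesis .
qed

definition diff_reps :: "real set \<Rightarrow> real \<Rightarrow> nat" where
  "diff_reps A d = card {a \<in> A. a + d \<in> A}"

definition prodset :: "real set \<Rightarrow> real set \<Rightarrow> real set" where
  "prodset A B = (\<lambda>(a, b). a * b) ` (A \<times> B)"

lemma finite_prodset [simp]: "finite A \<Longrightarrow> finite B \<Longrightarrow> finite (prodset A B)"
  by (simp add: prodset_def)

lemma prodsetI: "a \<in> A \<Longrightarrow> b \<in> B \<Longrightarrow> a * b \<in> prodset A B"
  unfolding prodset_def by force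

lemma diff_reps_le: "finite A \<Longrightarrow> diff_reps A d \<le> card A"
  unfolding diff_reps_def by (intro card_mono) auto

text \<open>
  The solutions in $V$ of $w (z - x) = w' (y - x')$, parametrised without $z = x + (w'/w)(y - x')$.
\<close>

definition ratio_diff_tuples :: "real set \<Rightarrow> (real \<times> real \<times> real \<times> real \<times> real) set" where
  "ratio_diff_tuples V = {(w, w', x, x', y). w \<in> V \<and> w' \<in> V \<and> x \<in> V \<and> x' \<in> V \<and> y \<in> V \<and>
     w' / w * y + (x - w' / w * x') \<in> V}"

text \<open>For fixed (w, w', x, x') the admissible y are the points of V x V on a line. With m =
  |V|, lines with fewer than k points contribute at most k m^4. By \<open>rich_lines\<close> there
  are at most 512 m^4 / k^3 others, each coming from at most m^2 quadruples and carrying at most m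
  points.\<close>

lemma card_ratio_diff_tuples:
  fixes V :: "real set" and k :: real
  assumes V: "finite V" "0 \<notin> V" and k: "8 \<le> k"
  shows "real (card (ratio_diff_tuples V)) \<le> k * real (card V) ^ 4 + 512 * real (card V) ^ 7 / k ^ 3"
proof -
  define m where "m = real (card V)"
  define Q where "Q = V \<times> V \<times> V \<times> V"
  define \<phi> where "\<phi> = (\<lambda>(w, w', x, x'). (w' / w, x - w' / w * (x'::real)) :: real \<times> real)"
  define \<rho> where "\<rho> l = card {y \<in> V. fst l * y + snd l \<in> V}" for l :: "real \<times> real"
  have finQ: "finite Q" unfolding Q_def using V by auto
  have cQ: "real (card Q) = m ^ 4"
    unfolding Q_def m_def card_cartesian_product by (simp add: power4_eq_xxxx)
  have "ratio_diff_tuples V = (\<lambda>((w, w', x, x'), y). (w, w', x, x', y)) `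
      (SIGMA q : Q. {y \<in> V. fst (\<phi> q) * y + snd (\<phi> q) \<in> V})"
    unfolding ratio_diff_tuples_def Q_def \<phi>_def by (auto simp: image_iff)
  then have "card (ratio_diff_tuples V) \<le> card (SIGMA q : Q. {y \<in> V. fst (\<phi> q) * y + snd (\<phi> q) \<in> V})"
    using finQ V by (simp only:) (intro card_image_le finite_SigmaI, auto)
  also have "\<dots> = (\<Sum>q\<in>Q. \<rho> (\<phi> q))" unfolding \<rho>_def using finQ V by simp
  finally have "real (card (ratio_diff_tuples V)) \<le> real (\<Sum>q\<in>Q. \<rho> (\<phi> q))"
    by (simp only: of_nat_le_iff)
  then have 1: "real (card (ratio_diff_tuples V)) \<le> (\<Sum>q\<in>Q. real (\<rho> (\<phi> q)))" by simp
  define H where "H = {q \<in> Q. k \<le> real (\<rho> (\<phi> q))}"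
  define L where "L = \<phi> ` H"
  have finH: "finite H" "finite L" unfolding L_def H_def using finQ by auto
  have \<rho>m: "real (\<rho> l) \<le> m" for l unfolding \<rho>_def m_def using V by (auto intro: card_mono)
  have "(\<Sum>q\<in>Q. real (\<rho> (\<phi> q))) \<le> (\<Sum>q\<in>Q. k + (if q \<in> H then m else 0))"
  proof (intro sum_mono)
    fix q assume "q \<in> Q"
    then show "real (\<rho> (\<phi> q)) \<le> k + (if q \<in> H then m else 0)"
      using \<rho>m[of "\<phi> q"] k by (auto simp: H_def)
  qed
  also have "\<dots> = k * m ^ 4 + m * real (card H)"
  proof -
    have "Q \<inter> H = H" by (auto simp: H_def)
    then show ?thesis by (simp add: sum.distrib sum.If_cases finQ cQ)
  qed
  finally have 2: "(\<Sum>q\<in>Q. real (\<rho> (\<phi> q))) \<le> k * m ^ 4 + m * real (card H)" .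
  \<comment> \<open>The slope is w'/w and the intercept x - (w'/w) x', so the line together with w
    and x' gives back w' and x.\<close>
  have "card H \<le> card (L \<times> V \<times> V)"
  proof (rule card_inj_on_le[of "\<lambda>q. (\<phi> q, fst q, snd (snd (snd q)))"])
    show "inj_on (\<lambda>q. (\<phi> q, fst q, snd (snd (snd q)))) H"
    proof (rule inj_on_inverseI[where g = "\<lambda>((s, b), w, x'). (w, s * w, b + s * x', x'::real)"])
      fix q assume "q \<in> H"
      moreover obtain w w1 x x1 where q: "q = (w, w1, x, x1)" by (metis surj_pair)
      ultimately have "w \<noteq> 0" using V by (auto simp: H_def Q_def)
      then show "(\<lambda>((s, b), w, x'). (w, s * w, b + s * x', x'::real)) (\<phi> q, fst q, snd (snd (snd q))) = q" by (simp add: \<phi>_def q)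
    qed
    show "(\<lambda>q. (\<phi> q, fst q, snd (snd (snd q)))) ` H \<subseteq> L \<times> V \<times> V"
      by (auto simp: L_def H_def Q_def)
  qed (use finH V in auto)
  then have "real (card H) \<le> real (card L * (card V * card V))"
    by (simp add: card_cartesian_product flip: of_nat_mult)
  then have cH: "real (card H) \<le> real (card L) * m\<^sup>2" by (simp add: m_def power2_eq_square)
  have "real (card L) * k ^ 3 \<le> 512 * (real (card V))\<^sup>2 * (real (card V))\<^sup>2"
  proof (rule rich_lines)
    fix s b assume "(s, b) \<in> L"
    then obtain q where q: "q \<in> H" "\<phi> q = (s, b)" unfolding L_def by auto
    then have "s \<noteq> 0" using V unfolding H_def Q_def \<phi>_def by auto
    moreover have "k \<le> real (\<rho> (s, b))" using q unfolding H_def by auto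
    ultimately show "s \<noteq> 0 \<and> k \<le> real (card {t \<in> V. s * t + b \<in> V})" by (simp add: \<rho>_def)
  qed (use V finH k in auto)
  then have cL: "real (card L) \<le> 512 * m ^ 4 / k ^ 3"
    using k by (simp add: field_simps m_def power4_eq_xxxx power2_eq_square)
  have m0: "m \<ge> 0" by (simp add: m_def)
  have "m * real (card H) \<le> m * ((512 * m ^ 4 / k ^ 3) * m\<^sup>2)"
    using cH cL m0 by (meson mult_left_mono mult_right_mono order_trans zero_le_power2)
  also have "\<dots> = 512 * m ^ 7 / k ^ 3" by (simp add: eval_nat_numeral)
  finally show ?thesis using 1 2 unfolding m_def by linarith
qed

text \<open>Cauchy-Schwarz over a in A, applied to the number of x with a + \<eta> x in A: on
  average a pair (x, x') has at least n/\<kappa>^2 common a. Each of these represents \<eta>(x - x')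
  as a difference of A, namely from a + \<eta> x' to a + \<eta> x. Pairs below half the average
  supply at most half of the total.\<close>

lemma popular_dense_pairs:
  fixes A V :: "real set" and \<eta> \<kappa> :: real
  assumes A: "finite A" "A \<noteq> {}" and V: "finite V" and \<kappa>: "1 \<le> \<kappa>"
    and pop: "\<And>x. x \<in> V \<Longrightarrow> real (card A) / \<kappa> \<le> real (diff_reps A (\<eta> * x))"
  shows "(real (card V))\<^sup>2 / (2 * \<kappa>\<^sup>2) \<le>
    real (card {(x, x') \<in> V \<times> V. real (card A) / (2 * \<kappa>\<^sup>2) \<le> real (diff_reps A (\<eta> * (x - x')))})"
    (is "_ \<le> real (card ?P)")
proof -
  define n where "n = real (card A)"
  define m where "m = real (card V)"
  have n0: "n > 0" using A by (simp add: n_def card_gt_0_iff)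
  define f where "f a = card {x \<in> V. a + \<eta> * x \<in> A}" for a
  define g where "g p = card {a \<in> A. a + \<eta> * fst p \<in> A \<and> a + \<eta> * snd p \<in> A}" for p
  have "m * (n / \<kappa>) = (\<Sum>x\<in>V. n / \<kappa>)" by (simp add: m_def)
  also have "\<dots> \<le> (\<Sum>x\<in>V. real (diff_reps A (\<eta> * x)))" using pop by (intro sum_mono) (simp add: n_def)
  also have "\<dots> = real (\<Sum>x\<in>V. diff_reps A (\<eta> * x))" by simp
  also have "(\<Sum>x\<in>V. diff_reps A (\<eta> * x)) = (\<Sum>a\<in>A. f a)"
    unfolding f_def diff_reps_def by (rule sum_card_swap[OF A(1) V, symmetric])
  also have "real (\<Sum>a\<in>A. f a) = (\<Sum>a\<in>A. real (f a))" by simp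
  finally have "(m * (n / \<kappa>))\<^sup>2 \<le> (\<Sum>a\<in>A. real (f a))\<^sup>2"
    using n0 \<kappa> by (intro power_mono) (auto simp: m_def)
  also have "\<dots> \<le> (\<Sum>a\<in>A. (real (f a))\<^sup>2) * n" unfolding n_def by (rule sum_squared_le_sum_of_squares)
  also have "(\<Sum>a\<in>A. (real (f a))\<^sup>2) = real (\<Sum>a\<in>A. card {p \<in> V \<times> V. a + \<eta> * fst p \<in> A \<and> a + \<eta> * snd p \<in> A})"
  proof -
    have "{p \<in> V \<times> V. a + \<eta> * fst p \<in> A \<and> a + \<eta> * snd p \<in> A} =
       {x \<in> V. a + \<eta> * x \<in> A} \<times> {x \<in> V. a + \<eta> * x \<in> A}" for a by auto
    then show ?thesis by (simp add: f_def power2_eq_square card_cartesian_product)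
  qed
  also have "(\<Sum>a\<in>A. card {p \<in> V \<times> V. a + \<eta> * fst p \<in> A \<and> a + \<eta> * snd p \<in> A}) = (\<Sum>p\<in>V \<times> V. g p)"
    unfolding g_def by (rule sum_card_swap) (use A V in auto)
  finally have "m\<^sup>2 * n / \<kappa>\<^sup>2 \<le> real (\<Sum>p\<in>V \<times> V. g p)"
  proof -
    assume "(m * (n / \<kappa>))\<^sup>2 \<le> real (\<Sum>p\<in>V \<times> V. g p) * n"
    then have "(m\<^sup>2 * n / \<kappa>\<^sup>2) * n \<le> real (\<Sum>p\<in>V \<times> V. g p) * n"
      by (simp add: power_mult_distrib power_divide power2_eq_square mult_ac)
    then show ?thesis using n0 by (simp only: mult_le_cancel_right_pos)
  qed
  also have "\<dots> \<le> (\<Sum>p\<in>V \<times> V. n / (2 * \<kappa>\<^sup>2) + (if p \<in> ?P then n else 0))"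
    unfolding of_nat_sum
  proof (intro sum_mono)
    fix p assume p: "p \<in> V \<times> V"
    have "g p \<le> diff_reps A (\<eta> * (fst p - snd p))"
      unfolding g_def diff_reps_def
      by (rule card_inj_on_le[of "\<lambda>a. a + \<eta> * snd p"]) (use A in \<open>auto simp: algebra_simps\<close>)
    moreover have "diff_reps A (\<eta> * (fst p - snd p)) \<le> card A" by (rule diff_reps_le[OF A(1)])
    ultimately show "real (g p) \<le> n / (2 * \<kappa>\<^sup>2) + (if p \<in> ?P then n else 0)"
      using p n0 \<kappa> by (auto simp: n_def split: prod.splits intro: add_increasing)
  qed
  also have "\<dots> = m\<^sup>2 * (n / (2 * \<kappa>\<^sup>2)) + real (card ?P) * n"
  proof -
    have "V \<times> V \<inter> ?P = ?P" by auto
    then show ?thesis using V by (simp add: sum.distrib sum.If_cases m_def power2_eq_square card_cartesian_product)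
  qed
  finally have half: "m\<^sup>2 * n / \<kappa>\<^sup>2 \<le> m\<^sup>2 * (n / (2 * \<kappa>\<^sup>2)) + real (card ?P) * n" .
  define z where "z = m\<^sup>2 / (2 * \<kappa>\<^sup>2) * n"
  have "m\<^sup>2 * n / \<kappa>\<^sup>2 = 2 * z" "m\<^sup>2 * (n / (2 * \<kappa>\<^sup>2)) = z" by (simp_all add: z_def)
  with half have "m\<^sup>2 / (2 * \<kappa>\<^sup>2) * n \<le> real (card ?P) * n" unfolding z_def[symmetric] by linarith
  then show ?thesis using n0 by (simp only: m_def n_def mult_le_cancel_right_pos)
qed

text \<open>The lines with slope w/u and intercept w \<eta> (x - x'), for popular pairs (x, x'), are
  rich in the grid AV x AV. Since |AV| is at most \<kappa> n, \<open>rich_lines\<close> allows only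
  O(\<kappa>^10 n) of them. Collisions among their parameters are solutions of w(x - x') = w'(y -
  y'), which are scarce, so there are many lines. The two bounds are compatible only for small
  V.\<close>

lemma popular_dilates_bounded:
  fixes A V :: "real set" and \<eta> \<kappa> :: real
  assumes A: "finite A" "A \<noteq> {}" and V: "finite V" "0 \<notin> V" and \<eta>: "\<eta> \<noteq> 0" and \<kappa>: "1 \<le> \<kappa>"
    and prod: "real (card (prodset A V)) \<le> \<kappa> * real (card A)"
    and pop: "\<And>x. x \<in> V \<Longrightarrow> real (card A) / \<kappa> \<le> real (diff_reps A (\<eta> * x))"
    and n_large: "16 * \<kappa>\<^sup>2 \<le> real (card A)"
    and n_small: "real (card A) \<le> (real (card V))\<^sup>2 * \<kappa> ^ 4"
  shows "real (card V) \<le> 2 ^ 69 * \<kappa> ^ 72"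
proof -
  define n where "n = real (card A)"
  define m where "m = real (card V)"
  \<comment> \<open>Chosen so that the final inequality reads m^5 \<le> (\<rho>/2) T, where T counts
    the ratio tuples: the term m^5/\<rho> in the bound for T then accounts for only half of
    m^5.\<close>
  define \<rho> where "\<rho> = 2 ^ 15 * \<kappa> ^ 18"
  have n0: "n > 0" using A by (simp add: n_def card_gt_0_iff)
  have \<rho>0: "\<rho> > 0" using \<kappa> by (simp add: \<rho>_def)
  define P where "P = {(x, x') \<in> V \<times> V. n / (2 * \<kappa>\<^sup>2) \<le> real (diff_reps A (\<eta> * (x - x')))}"
  have finP: "finite P" unfolding P_def using V by (auto intro: finite_subset[of _ "V \<times> V"])
  have cP: "m\<^sup>2 / (2 * \<kappa>\<^sup>2) \<le> real (card P)"
    unfolding P_def m_def n_def by (rule popular_dense_pairs) (use A V \<kappa> pop in auto)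
  define J where "J = V \<times> V \<times> P"
  define F where "F = (\<lambda>(w, u, x, x'). (w / u, w * (\<eta> * (x - x'))) :: real \<times> real)"
  have finJ: "finite J" unfolding J_def using V finP by auto
  have cJ: "real (card J) = m\<^sup>2 * real (card P)"
    unfolding J_def by (simp add: card_cartesian_product m_def power2_eq_square)
  let ?C = "{(i, j). i \<in> J \<and> j \<in> J \<and> F i = F j}"
  let ?f = "\<lambda>((w::real, u::real, x::real, x'::real), (w1::real, u1::real, x1::real, x1'::real)). ((w, w1, x', x1', x1), u)"
  \<comment> \<open>In a collision x follows from w(x - x') = w1(x1 - x1') and u1 from w/u = w1/u1,
    so six of the eight coordinates suffice.\<close>
  let ?g = "\<lambda>((w::real, w1, x', x1', x1), u). ((w, u, w1 / w * x1 + (x' - w1 / w * x1'), x'), (w1, (u::real) * w1 / w, x1, x1'::real))"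
  have "card ?C \<le> card (ratio_diff_tuples V \<times> V)"
  proof (rule card_inj_on_le[of ?f])
    have nz: "w \<noteq> 0" if "(w, u, p) \<in> J" for w u p using that V by (auto simp: J_def)
    have nz': "u \<noteq> 0" if "(w, u, p) \<in> J" for w u p using that V by (auto simp: J_def)
    have key: "x = w1 / w * x1 + (x' - w1 / w * x1') \<and> u1 = u * w1 / w"
      if "(w, u, x, x') \<in> J" "(w1, u1, x1, x1') \<in> J" "F (w, u, x, x') = F (w1, u1, x1, x1')"
      for w u x x' w1 u1 x1 x1'
    proof -
      have "w * (x - x') = w1 * (x1 - x1')" "w / u = w1 / u1" using that(3) \<eta> by (auto simp: F_def)
      then show ?thesis using nz[OF that(1)] nz[OF that(2)] nz'[OF that(1)] nz'[OF that(2)]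
        by (auto simp: field_simps)
    qed
    show "inj_on ?f ?C"
    proof (rule inj_on_inverseI[where g =
        ?g])
      fix p assume "p \<in> ?C"
      moreover obtain w u x x' w1 u1 x1 x1' where p: "p = ((w, u, x, x'), (w1, u1, x1, x1'))"
        by (metis surj_pair)
      ultimately have "(w, u, x, x') \<in> J" "(w1, u1, x1, x1') \<in> J" "F (w, u, x, x') = F (w1, u1, x1, x1')"
        by auto
      from key[OF this] show "?g (?f p) = p"
        by (simp add: p)
    qed
    show "?f ` ?C \<subseteq> ratio_diff_tuples V \<times> V"
    proof (rule image_subsetI)
      fix p assume "p \<in> ?C"
      moreover obtain w u x x' w1 u1 x1 x1' where p: "p = ((w, u, x, x'), (w1, u1, x1, x1'))"
        by (metis surj_pair)
      ultimately have *: "(w, u, x, x') \<in> J" "(w1, u1, x1, x1') \<in> J" "F (w, u, x, x') = F (w1, u1, x1, x1')"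
        by auto
      then have "w1 / w * x1 + (x' - w1 / w * x1') = x" using key by metis
      then show "?f p \<in> ratio_diff_tuples V \<times> V"
        using * by (auto simp: p J_def P_def ratio_diff_tuples_def)
    qed
    have "ratio_diff_tuples V \<subseteq> V \<times> V \<times> V \<times> V \<times> V" by (auto simp: ratio_diff_tuples_def)
    from finite_subset[OF this] show "finite (ratio_diff_tuples V \<times> V)" using V by simp
  qed
  then have cC: "real (card ?C) \<le> real (card (ratio_diff_tuples V)) * m"
    unfolding m_def card_cartesian_product of_nat_mult[symmetric] by (simp only: of_nat_le_iff)
  have "real (card (F ` J)) * (n / (2 * \<kappa>\<^sup>2)) ^ 3 \<le>
      512 * (real (card (prodset A V)))\<^sup>2 * (real (card (prodset A V)))\<^sup>2"
  proof (rule rich_lines)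
    show "8 \<le> n / (2 * \<kappa>\<^sup>2)" using n_large \<kappa> by (simp add: field_simps n_def)
    fix s b assume "(s, b) \<in> F ` J"
    then obtain w u x x' where *: "w \<in> V" "u \<in> V" "(x, x') \<in> P" "s = w / u" "b = w * (\<eta> * (x - x'))"
      unfolding J_def F_def by auto
    then have nz: "w \<noteq> 0" "u \<noteq> 0" using V by auto
    \<comment> \<open>If a and a + \<eta>(x - x') are in A, the line passes through the grid point
      with coordinates a u and (a + \<eta>(x - x')) w.\<close>
    have "diff_reps A (\<eta> * (x - x')) \<le> card {t \<in> prodset A V. s * t + b \<in> prodset A V}"
      unfolding diff_reps_def
    proof (rule card_inj_on_le[of "\<lambda>a. a * u"])
      show "(\<lambda>a. a * u) ` {a \<in> A. a + \<eta> * (x - x') \<in> A} \<subseteq> {t \<in> prodset A V. s * t + b \<in> prodset A V}"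
      proof (rule image_subsetI, clarify)
        fix a assume a: "a \<in> A" "a + \<eta> * (x - x') \<in> A"
        have "s * (a * u) + b = (a + \<eta> * (x - x')) * w" using * nz by (simp add: field_simps)
        then show "a * u \<in> prodset A V \<and> s * (a * u) + b \<in> prodset A V"
          using a * by (simp add: prodsetI)
      qed
    qed (use nz A V in \<open>auto simp: inj_on_def\<close>)
    then show "s \<noteq> 0 \<and> n / (2 * \<kappa>\<^sup>2) \<le> real (card {t \<in> prodset A V. s * t + b \<in> prodset A V})"
      using * nz by (auto simp: P_def)
  qed (use A V finJ in auto)
  also have "\<dots> \<le> 512 * (\<kappa> * n)\<^sup>2 * (\<kappa> * n)\<^sup>2"
    using prod by (intro mult_mono power_mono) (auto simp: n_def)
  finally have "real (card (F ` J)) * (n / (2 * \<kappa>\<^sup>2)) ^ 3 * (8 * \<kappa> ^ 6) \<le>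
      512 * (\<kappa> * n)\<^sup>2 * (\<kappa> * n)\<^sup>2 * (8 * \<kappa> ^ 6)"
    using \<kappa> by (intro mult_right_mono) auto
  then have "real (card (F ` J)) * n ^ 3 \<le> (4096 * \<kappa> ^ 10 * n) * n ^ 3"
    using \<kappa> by (simp add: power_divide power_mult_distrib eval_nat_numeral mult_ac)
  then have cF: "real (card (F ` J)) \<le> 4096 * \<kappa> ^ 10 * n" using n0 by simp
  have low: "m ^ 8 / (4 * \<kappa> ^ 4) \<le> (real (card J))\<^sup>2"
  proof -
    have "m\<^sup>2 * (m\<^sup>2 / (2 * \<kappa>\<^sup>2)) \<le> real (card J)" unfolding cJ using cP by (intro mult_left_mono) auto
    then have "(m\<^sup>2 * (m\<^sup>2 / (2 * \<kappa>\<^sup>2)))\<^sup>2 \<le> (real (card J))\<^sup>2" using \<kappa> by (intro power_mono) auto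
    moreover have "m ^ 8 / (4 * \<kappa> ^ 4) = (m\<^sup>2 * (m\<^sup>2 / (2 * \<kappa>\<^sup>2)))\<^sup>2"
      by (simp add: power_divide power_mult_distrib flip: power_mult power_add)
    ultimately show ?thesis by simp
  qed
  show ?thesis
  \<comment> \<open>Below 8 \<rho> the claim is immediate; otherwise k = m/\<rho> is at least 8, as
    \<open>card_ratio_diff_tuples\<close> demands.\<close>
  proof (cases "m < 8 * \<rho>")
    case True
    have "m \<le> 2 ^ 18 * \<kappa> ^ 18" using True by (simp add: \<rho>_def)
    also have "\<dots> \<le> 2 ^ 69 * \<kappa> ^ 72" using \<kappa> by (intro mult_mono power_increasing) auto
    finally show ?thesis by (simp add: m_def)
  next
    case False
    then have mp: "m > 0" using \<rho>0 by linarith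
    let ?T = "real (card (ratio_diff_tuples V))"
    have "?T \<le> m / \<rho> * m ^ 4 + 512 * m ^ 7 / (m / \<rho>) ^ 3"
      unfolding m_def by (rule card_ratio_diff_tuples)
         (use V False \<rho>0 in \<open>auto simp: field_simps m_def\<close>)
    also have "\<dots> = m ^ 5 / \<rho> + 512 * m ^ 4 * \<rho> ^ 3"
      using mp \<rho>0 by (simp add: power_divide eval_nat_numeral)
    finally have T: "?T \<le> m ^ 5 / \<rho> + 512 * m ^ 4 * \<rho> ^ 3" .
    have "m ^ 8 / (4 * \<kappa> ^ 4) \<le> real (card (F ` J)) * real (card ?C)"
      using low card_square_le_collisions[OF finJ, of F] by linarith
    also have "\<dots> \<le> (4096 * \<kappa> ^ 10 * n) * (?T * m)"
      using cF cC \<kappa> n0 by (intro mult_mono) auto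
    also have "\<dots> \<le> (4096 * \<kappa> ^ 10 * (m\<^sup>2 * \<kappa> ^ 4)) * (?T * m)"
      using n_small \<kappa> mp by (intro mult_mono) (auto simp: n_def m_def)
    finally have "m ^ 8 / (4 * \<kappa> ^ 4) * (4 * \<kappa> ^ 4) \<le>
        (4096 * \<kappa> ^ 10 * (m\<^sup>2 * \<kappa> ^ 4)) * (?T * m) * (4 * \<kappa> ^ 4)"
      using \<kappa> by (intro mult_right_mono) auto
    then have "m ^ 3 * m ^ 5 \<le> m ^ 3 * (2 ^ 14 * \<kappa> ^ 18 * ?T)"
      using \<kappa> by (simp add: eval_nat_numeral mult_ac)
    then have "m ^ 5 \<le> 2 ^ 14 * \<kappa> ^ 18 * ?T" by (rule mult_left_le_imp_le) (use mp in simp)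
    also have "\<dots> = \<rho> / 2 * ?T" by (simp add: \<rho>_def)
    also have "\<dots> \<le> \<rho> / 2 * (m ^ 5 / \<rho> + 512 * m ^ 4 * \<rho> ^ 3)" using T \<rho>0 by (intro mult_left_mono) auto
    also have "\<dots> = m ^ 5 / 2 + 256 * m ^ 4 * \<rho> ^ 4" using \<rho>0 by (simp add: distrib_left eval_nat_numeral)
    finally have "m ^ 5 \<le> m ^ 5 / 2 + 256 * m ^ 4 * \<rho> ^ 4" .
    moreover have "m ^ 5 = m ^ 4 * m" by (simp add: eval_nat_numeral)
    ultimately have "m ^ 4 * m \<le> m ^ 4 * (512 * \<rho> ^ 4)" by linarith
    then have "m \<le> 512 * \<rho> ^ 4" using mp by simp
    also have "\<dots> = 2 ^ 69 * \<kappa> ^ 72" unfolding \<rho>_def by (simp add: power_mult_distrib flip: power_mult)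
    finally show ?thesis by (simp add: m_def)
  qed
qed

text \<open>Let W consist of the x with at least k solutions c. For x in W and u in U the line t ->
  (\<alpha>/u) t + \<beta> x meets AU x B in the points with t = c u, and distinct (u, x) give
  distinct lines, so \<open>rich_lines\<close> bounds |U| |W|. The remaining x account for at most k
  |X| solutions.\<close>

lemma linear_form_solutions:
  fixes A U X B :: "real set" and \<alpha> \<beta> k :: real
  assumes fin: "finite A" "finite U" "finite X" "finite B" and U: "0 \<notin> U"
    and nz: "\<alpha> \<noteq> 0" "\<beta> \<noteq> 0" and k: "8 \<le> k"
  shows "real (card U) * (real (card {(x, c) \<in> X \<times> A. \<alpha> * c + \<beta> * x \<in> B}) - k * real (card X)) * k ^ 3
    \<le> 512 * real (card A) * (real (card (prodset A U)))\<^sup>2 * (real (card B))\<^sup>2"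
proof -
  define f where "f x = card {c \<in> A. \<alpha> * c + \<beta> * x \<in> B}" for x
  define W where "W = {x \<in> X. k \<le> real (f x)}"
  have finW: "finite W" using fin by (simp add: W_def)
  have "{(x, c) \<in> X \<times> A. \<alpha> * c + \<beta> * x \<in> B} = (SIGMA x : X. {c \<in> A. \<alpha> * c + \<beta> * x \<in> B})" by auto
  then have "real (card {(x, c) \<in> X \<times> A. \<alpha> * c + \<beta> * x \<in> B}) = (\<Sum>x\<in>X. real (f x))"
    using fin by (simp add: f_def)
  also have "\<dots> \<le> (\<Sum>x\<in>X. k + (if x \<in> W then real (card A) else 0))"
  proof (intro sum_mono)
    fix x assume "x \<in> X"
    moreover have "f x \<le> card A" unfolding f_def using fin by (intro card_mono) auto
    ultimately show "real (f x) \<le> k + (if x \<in> W then real (card A) else 0)"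
      using k by (auto simp: W_def)
  qed
  also have "\<dots> = k * real (card X) + real (card W) * real (card A)"
  proof -
    have "X \<inter> W = W" by (auto simp: W_def)
    then show ?thesis using fin by (simp add: sum.distrib sum.If_cases)
  qed
  finally have N: "real (card {(x, c) \<in> X \<times> A. \<alpha> * c + \<beta> * x \<in> B}) - k * real (card X)
     \<le> real (card W) * real (card A)" by simp
  define \<phi> where "\<phi> = (\<lambda>(u, x). (\<alpha> / u, \<beta> * x))"
  have "inj_on \<phi> (U \<times> W)" using nz U by (auto simp: inj_on_def \<phi>_def)
  then have cL: "card (\<phi> ` (U \<times> W)) = card U * card W"
    by (simp add: card_image card_cartesian_product)
  have "real (card (\<phi> ` (U \<times> W))) * k ^ 3 \<le> 512 * (real (card (prodset A U)))\<^sup>2 * (real (card B))\<^sup>2"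
  proof (rule rich_lines)
    fix s b assume "(s, b) \<in> \<phi> ` (U \<times> W)"
    then obtain u x where *: "u \<in> U" "x \<in> W" "s = \<alpha> / u" "b = \<beta> * x" unfolding \<phi>_def by auto
    then have u: "u \<noteq> 0" using U by auto
    have "f x \<le> card {t \<in> prodset A U. s * t + b \<in> B}" unfolding f_def
      by (rule card_inj_on_le[of "\<lambda>c. c * u"]) (use u * fin in \<open>auto simp: inj_on_def prodsetI\<close>)
    then show "s \<noteq> 0 \<and> k \<le> real (card {t \<in> prodset A U. s * t + b \<in> B})"
      using * u nz by (auto simp: W_def)
  qed (use fin finW k in auto)
  then have "real (card A) * (real (card U) * real (card W) * k ^ 3) \<le>
      real (card A) * (512 * (real (card (prodset A U)))\<^sup>2 * (real (card B))\<^sup>2)"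
    unfolding cL of_nat_mult by (rule mult_left_mono) simp
  moreover have "real (card U) * (real (card {(x, c) \<in> X \<times> A. \<alpha> * c + \<beta> * x \<in> B}) - k * real (card X)) * k ^ 3
     \<le> real (card U) * (real (card W) * real (card A)) * k ^ 3"
    using N k by (intro mult_right_mono mult_left_mono) auto
  ultimately show ?thesis by (simp add: mult_ac)
qed

section \<open>Packing sums into cones\<close>

text \<open>For finite nonempty \<open>I\<close> this is the cone between the smallest and the
  largest slope. The existential form is monotone in \<open>I\<close> and avoids naming the
  extremes.\<close>

definition in_cone :: "real set \<Rightarrow> (real \<times> real) set \<Rightarrow> bool" where
  "in_cone I Z \<longleftrightarrow> (\<forall>(p, q)\<in>Z. p > 0 \<and> (\<exists>l\<in>I. l * p \<le> q) \<and> (\<exists>l\<in>I. q \<le> l * p))"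

lemma in_cone_mono: "in_cone I Z \<Longrightarrow> I \<subseteq> I' \<Longrightarrow> in_cone I' Z"
  unfolding in_cone_def by fast

lemma in_cone_sums:
  assumes "\<And>z. z \<in> Z \<Longrightarrow> \<exists>l\<in>I. \<exists>m\<in>I. \<exists>x>0. \<exists>y>0. z = (x + y, l * x + m * y)"
  shows "in_cone I Z"
  unfolding in_cone_def
proof (clarify)
  fix p q assume "(p, q) \<in> Z"
  from assms[OF this] obtain l m x y where *: "l \<in> I" "m \<in> I" "x > 0" "y > 0"
    "p = x + y" "q = l * x + m * y" by auto
  have "min l m * p \<le> q"
    unfolding * distrib_left using * by (intro add_mono mult_right_mono) auto
  moreover have "q \<le> max l m * p"
    unfolding * distrib_left using * by (intro add_mono mult_right_mono) auto
  moreover have "min l m \<in> I" "max l m \<in> I" using * by (auto simp: min_def max_def)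
  ultimately show "p > 0 \<and> (\<exists>l\<in>I. l * p \<le> q) \<and> (\<exists>l\<in>I. q \<le> l * p)" using * by auto
qed

lemma in_cone_disjoint:
  assumes "in_cone I Z" "in_cone I' Z'" "\<And>l l'. l \<in> I \<Longrightarrow> l' \<in> I' \<Longrightarrow> l < l'"
  shows "Z \<inter> Z' = {}"
proof (rule ccontr)
  assume "Z \<inter> Z' \<noteq> {}"
  then obtain p q where "(p, q) \<in> Z" "(p, q) \<in> Z'" by auto
  then obtain l l' where "p > 0" "l \<in> I" "l' \<in> I'" "q \<le> l * p" "l' * p \<le> q"
    using assms(1,2) unfolding in_cone_def by fast
  moreover from this have "l * p < l' * p" using assms(3) by simp
  ultimately show False by linarith
qed

lemma obtain_largest:
  fixes \<Lambda> :: "real set"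
  assumes "finite \<Lambda>" "M \<le> card \<Lambda>"
  shows "\<exists>I\<subseteq>\<Lambda>. card I = M \<and> (\<forall>l\<in>\<Lambda> - I. \<forall>l'\<in>I. l < l')"
  using assms(2)
proof (induction M)
  case (Suc M)
  then obtain I where I: "I \<subseteq> \<Lambda>" "card I = M" "\<forall>l\<in>\<Lambda> - I. \<forall>l'\<in>I. l < l'" by auto
  have fin: "finite (\<Lambda> - I)" "finite I" using assms I finite_subset by auto
  have "\<Lambda> - I \<noteq> {}"
  proof
    assume "\<Lambda> - I = {}"
    then have "\<Lambda> = I" using I by auto
    then show False using I Suc by simp
  qed
  then have mx: "Max (\<Lambda> - I) \<in> \<Lambda> - I" using fin by (intro Max_in) auto
  have "l < l'" if "l \<in> \<Lambda> - insert (Max (\<Lambda> - I)) I" "l' \<in> insert (Max (\<Lambda> - I)) I" for l l'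
  proof (cases "l' \<in> I")
    case False
    then have "l' = Max (\<Lambda> - I)" using that by auto
    moreover have "l \<le> Max (\<Lambda> - I)" using that fin by (intro Max_ge) auto
    ultimately show ?thesis using that by auto
  qed (use I that in auto)
  moreover have "card (insert (Max (\<Lambda> - I)) I) = Suc M" using mx fin I by auto
  ultimately show ?case using mx I by (intro exI[of _ "insert (Max (\<Lambda> - I)) I"]) auto
qed (intro exI[of _ "{}"], simp)

text \<open>The M largest slopes are removed again and again. The sets \<open>Z\<close> of
  successive blocks lie in disjoint cones, so their sizes add up inside S x S. Fewer than M slopes
  remain at the end, and they cost at most M W of weight.\<close>

lemma cone_packing:
  fixes \<Lambda> S :: "real set" and w :: "real \<Rightarrow> real"
  assumes fin: "finite \<Lambda>" "finite S" and g: "0 \<le> g" and M: "0 < M"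
    and w: "\<And>l. l \<in> \<Lambda> \<Longrightarrow> w l \<le> W"
    and block: "\<And>I. I \<subseteq> \<Lambda> \<Longrightarrow> card I = M \<Longrightarrow>
      \<exists>Z\<subseteq>S \<times> S. in_cone I Z \<and> g * sum w I \<le> real (card Z)"
    and W: "0 \<le> W"
  shows "g * (sum w \<Lambda> - real M * W) \<le> (real (card S))\<^sup>2"
proof -
  \<comment> \<open>The induction also records that \<open>Z\<close> stays in the cone of the slopes
    used, which makes it disjoint from the block above.\<close>
  have "\<exists>Z\<subseteq>S \<times> S. in_cone \<Lambda>' Z \<and> g * (sum w \<Lambda>' - real M * W) \<le> real (card Z)" if "\<Lambda>' \<subseteq> \<Lambda>" for \<Lambda>'
    using that
  proof (induction "card \<Lambda>'" arbitrary: \<Lambda>' rule: less_induct)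
    case less
    have fin': "finite \<Lambda>'" using less(2) fin finite_subset by auto
    show ?case
    proof (cases "M \<le> card \<Lambda>'")
      case False
      have "sum w \<Lambda>' \<le> real (card \<Lambda>') * W" using less(2) w by (intro sum_bounded_above) auto
      also have "\<dots> \<le> real M * W" using False W by (intro mult_right_mono) auto
      finally have "g * (sum w \<Lambda>' - real M * W) \<le> 0" using g by (simp add: mult_nonneg_nonpos)
      then show ?thesis by (intro exI[of _ "{}"]) (simp add: in_cone_def)
    next
      case True
      then obtain I where I: "I \<subseteq> \<Lambda>'" "card I = M" "\<forall>l\<in>\<Lambda>' - I. \<forall>l'\<in>I. l < l'"
        using obtain_largest[OF fin'] by blast
      have finI: "finite I" using I fin' finite_subset by auto
      have "card (\<Lambda>' - I) < card \<Lambda>'" using I M fin' finI True by (simp add: card_Diff_subset)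
      then obtain Z where Z: "Z \<subseteq> S \<times> S" "in_cone (\<Lambda>' - I) Z"
        "g * (sum w (\<Lambda>' - I) - real M * W) \<le> real (card Z)" using less by (metis Diff_subset order_trans)
      obtain Z' where Z': "Z' \<subseteq> S \<times> S" "in_cone I Z'" "g * sum w I \<le> real (card Z')"
        using block[of I] I less(2) by auto
      have "finite (S \<times> S)" using fin by simp
      then have "finite Z" "finite Z'" using Z Z' finite_subset by blast+
      moreover have "Z \<inter> Z' = {}" by (rule in_cone_disjoint[OF Z(2) Z'(2)]) (use I in auto)
      ultimately have "card (Z \<union> Z') = card Z + card Z'" by (rule card_Un_disjoint)
      moreover have "sum w \<Lambda>' = sum w (\<Lambda>' - I) + sum w I" using I fin' by (simp add: sum.subset_diff)
      ultimately have "g * (sum w \<Lambda>' - real M * W) \<le> real (card (Z \<union> Z'))"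
        using Z(3) Z'(3) by (simp add: algebra_simps)
      moreover have "in_cone \<Lambda>' (Z \<union> Z')"
        using in_cone_mono[OF Z(2), of \<Lambda>'] in_cone_mono[OF Z'(2) I(1)] unfolding in_cone_def by blast
      ultimately show ?thesis using Z Z' by (intro exI[of _ "Z \<union> Z'"]) auto
    qed
  qed
  from this[of \<Lambda>] obtain Z where Z: "Z \<subseteq> S \<times> S" "g * (sum w \<Lambda> - real M * W) \<le> real (card Z)" by auto
  have "card Z \<le> card (S \<times> S)" using Z fin by (intro card_mono) auto
  then have "card Z \<le> card S * card S" by (simp add: card_cartesian_product)
  then have "real (card Z) \<le> real (card S * card S)" by (simp only: of_nat_le_iff)
  then show ?thesis using Z by (simp add: power2_eq_square)
qed

lemma injection_card_le:
  assumes "inj_on f E" "f ` E \<subseteq> B" "finite B"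
  shows "real (card E) \<le> real (card B)"
  using card_inj_on_le[OF assms] by simp

text \<open>With s = |I| and n = |A|, coincidences fall into three classes. Different l: the four
  slopes determine c and c', giving s^4 \<le> s^2 n. Equal l and m: only the diagonal. Equal l,
  different m: the difference of the two summands is parallel to l, so m and m' determine l. Each
  class has at most s^2 n members, whence the factor 1/3.\<close>

lemma parallel_segments_block:
  fixes I A :: "real set" and a :: "real \<Rightarrow> real"
  assumes fin: "finite I" "finite A" and a: "\<And>l. l \<in> I \<Longrightarrow> a l > 0"
    and I: "I \<noteq> {}" and A: "A \<noteq> {}" and sq: "(card I)\<^sup>2 \<le> card A"
  shows "(real (card I))\<^sup>2 * real (card A) / 3 \<le>
    real (card ((\<lambda>(l, m, c). (c * a l + a m, l * (c * a l) + m * a m)) ` (I \<times> I \<times> A)))"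
proof -
  define s where "s = real (card I)"
  define n where "n = real (card A)"
  define F where "F = (\<lambda>(l, m, c). (c * a l + a m, l * (c * a l) + m * a m))"
  define J where "J = I \<times> I \<times> A"
  have pos: "s > 0" "n > 0" using fin I A by (auto simp: s_def n_def card_gt_0_iff)
  have sn: "s\<^sup>2 \<le> n" using sq unfolding s_def n_def by (metis of_nat_le_iff of_nat_power)
  have finJ: "finite J" unfolding J_def using fin by simp
  define E where "E = {(i, j). i \<in> J \<and> j \<in> J \<and> F i = F j}"
  define E1 where "E1 = {(i, j) \<in> E. fst i \<noteq> fst j}"
  define E2 where "E2 = {(i, j) \<in> E. fst i = fst j \<and> fst (snd i) = fst (snd j)}"
  define E3 where "E3 = {(i, j) \<in> E. fst i = fst j \<and> fst (snd i) \<noteq> fst (snd j)}"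
  have "finite E" unfolding E_def using finJ by (auto intro: finite_subset[of _ "J \<times> J"])
  then have fE: "finite E1" "finite E2" "finite E3"
    unfolding E1_def E2_def E3_def by (auto intro: finite_subset[of _ E])
  have "E = E1 \<union> E2 \<union> E3" unfolding E1_def E2_def E3_def by auto
  then have "card E \<le> card E1 + card E2 + card E3"
    by (metis card_Un_le add_le_mono1 order_trans)
  then have E123: "real (card E) \<le> real (card E1) + real (card E2) + real (card E3)" by linarith
  have E_dest: "l \<in> I \<and> m \<in> I \<and> c \<in> A \<and> l' \<in> I \<and> m' \<in> I \<and> c' \<in> A \<and> a l > 0 \<and> a l' > 0 \<and>
     c * a l + a m = c' * a l' + a m' \<and> l * (c * a l) + m * a m = l' * (c' * a l') + m' * a m'"
    if "((l, m, c), (l', m', c')) \<in> E" for l m c l' m' c'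
    using that a unfolding E_def J_def F_def by auto
  \<comment> \<open>Subtracting l' times the first coordinate from the second eliminates c';
    subtracting l times it eliminates c.\<close>
  have key1: "c = ((m' - l') * a m' - (m - l') * a m) / ((l - l') * a l)"
    "c' = ((m - l) * a m - (m' - l) * a m') / ((l' - l) * a l')"
    if e: "((l, m, c), (l', m', c')) \<in> E" "l \<noteq> l'" for l m c l' m' c'
  proof -
    note d = E_dest[OF e(1)]
    have 1: "l * (c * a l) + m * a m - l' * (c * a l + a m) = l' * (c' * a l') + m' * a m' - l' * (c' * a l' + a m')"
      using d by presburger
    have 2: "l * (c * a l) + m * a m - l * (c * a l + a m) = l' * (c' * a l') + m' * a m' - l * (c' * a l' + a m')"
      using d by presburger
    have "c * ((l - l') * a l) = (m' - l') * a m' - (m - l') * a m" using 1 by (simp add: algebra_simps)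
    then show "c = ((m' - l') * a m' - (m - l') * a m) / ((l - l') * a l)" using d e by (simp add: eq_divide_eq)
    have "c' * ((l' - l) * a l') = (m - l) * a m - (m' - l) * a m'" using 2 by (simp add: algebra_simps)
    then show "c' = ((m - l) * a m - (m' - l) * a m') / ((l' - l) * a l')" using d e by (simp add: eq_divide_eq)
  qed
  have "real (card E1) \<le> real (card (I \<times> I \<times> I \<times> I))"
  proof (rule injection_card_le)
    let ?f = "\<lambda>((l::real, m::real, c::real), (l'::real, m'::real, c'::real)). (l, m, l', m')"
    let ?g = "\<lambda>(l, m, l', m'). ((l, m, ((m' - l') * a m' - (m - l') * a m) / ((l - l') * a l)),
        (l', m', ((m - l) * a m - (m' - l) * a m') / ((l' - l) * a l')))"
    show "inj_on ?f E1"
    proof (rule inj_on_inverseI[where g = ?g])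
      fix p assume "p \<in> E1"
      moreover obtain l m c l' m' c' where p: "p = ((l, m, c), (l', m', c'))" by (metis surj_pair)
      ultimately have "((l, m, c), (l', m', c')) \<in> E" "l \<noteq> l'" by (auto simp: E1_def)
      from key1[OF this] show "?g (?f p) = p" by (simp add: p)
    qed
    show "?f ` E1 \<subseteq> I \<times> I \<times> I \<times> I" unfolding E1_def E_def J_def by auto
  qed (use fin in auto)
  then have 1: "real (card E1) \<le> s ^ 4" by (simp add: card_cartesian_product s_def power4_eq_xxxx)
  have "real (card E2) \<le> real (card J)"
  proof (rule injection_card_le)
    show "inj_on fst E2"
    proof (rule inj_on_inverseI[where g = "\<lambda>i. (i, i)"])
      fix p assume "p \<in> E2"
      moreover obtain l m c l' m' c' where p: "p = ((l, m, c), (l', m', c'))" by (metis surj_pair)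
      ultimately have *: "((l, m, c), (l', m', c')) \<in> E" "l = l'" "m = m'" by (auto simp: E2_def)
      from E_dest[OF *(1)] show "(fst p, fst p) = p" using * by (auto simp: p)
    qed
    show "fst ` E2 \<subseteq> J" unfolding E2_def E_def by auto
  qed (use finJ in auto)
  then have 2: "real (card E2) \<le> s\<^sup>2 * n"
    by (simp add: card_cartesian_product s_def n_def J_def power2_eq_square)
  have "real (card E3) \<le> real (card J)"
  proof (rule injection_card_le)
    let ?f = "\<lambda>((l::real, m::real, c::real), (l'::real, m'::real, c'::real)). (m, m', c)"
    \<comment> \<open>The slope of the vector joining the points of abscissa \<open>a m\<close> and
      \<open>a m'\<close> on the rays m and m'.\<close>
    let ?l = "\<lambda>m m'. (m' * a m' - m * a m) / (a m' - a m)"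
    let ?g = "\<lambda>(m, m', c). ((?l m m', m, c), (?l m m', m', c - (a m' - a m) / a (?l m m')))"
    show "inj_on ?f E3"
    proof (rule inj_on_inverseI[where g = ?g])
      fix p assume "p \<in> E3"
      moreover obtain l m c l' m' c' where p: "p = ((l, m, c), (l', m', c'))" by (metis surj_pair)
      ultimately have *: "((l, m, c), (l', m', c')) \<in> E" "l = l'" "m \<noteq> m'" by (auto simp: E3_def)
      have d: "m' \<in> I" "a l > 0" "c * a l + a m = c' * a l + a m'" 
        "l * (c * a l) + m * a m = l * (c' * a l) + m' * a m'"
        using E_dest[OF *(1)] *(2) by auto
      have D: "(c - c') * a l = a m' - a m" "l * ((c - c') * a l) = m' * a m' - m * a m"
        using d by (auto simp: algebra_simps)
      \<comment> \<open>Equal first coordinates would force equal second ones, hence m = m' because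
        \<open>a m'\<close> is positive.\<close>
      have ne: "a m' - a m \<noteq> 0"
      proof
        assume z: "a m' - a m = 0"
        have "m' * a m' - m * a m = 0" unfolding D(2)[symmetric] D(1) z by simp
        then have "m' * a m' = m * a m'" using z by simp
        then show False using a[OF d(1)] * by simp
      qed
      have "m' * a m' - m * a m = l * (a m' - a m)" unfolding D(1)[symmetric] D(2) ..
      then have l: "?l m m' = l" using ne by simp
      have "c - (a m' - a m) / a l = c'" using D d by (simp add: field_simps)
      then show "?g (?f p) = p" using l * by (simp add: p)
    qed
    show "?f ` E3 \<subseteq> J" unfolding E3_def E_def J_def by auto
  qed (use finJ in auto)
  then have 3: "real (card E3) \<le> s\<^sup>2 * n"
    by (simp add: card_cartesian_product s_def n_def J_def power2_eq_square)
  have "s ^ 4 = s\<^sup>2 * s\<^sup>2" by (simp add: eval_nat_numeral)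
  also have "\<dots> \<le> s\<^sup>2 * n" using sn by (intro mult_left_mono) auto
  finally have E: "real (card E) \<le> 3 * (s\<^sup>2 * n)" using E123 1 2 3 by linarith
  have "(s\<^sup>2 * n)\<^sup>2 = (real (card J))\<^sup>2"
    by (simp add: card_cartesian_product s_def n_def J_def power2_eq_square)
  also have "\<dots> \<le> real (card (F ` J)) * real (card E)"
    unfolding E_def by (rule card_square_le_collisions[OF finJ])
  also have "\<dots> \<le> real (card (F ` J)) * (3 * (s\<^sup>2 * n))" using E by (intro mult_left_mono) auto
  finally have "s\<^sup>2 * n * (s\<^sup>2 * n) \<le> (real (card (F ` J)) * 3) * (s\<^sup>2 * n)"
    by (simp add: power2_eq_square mult_ac)
  then have "s\<^sup>2 * n \<le> real (card (F ` J)) * 3" by (rule mult_right_le_imp_le) (use pos in simp)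
  then show ?thesis unfolding s_def n_def F_def J_def by simp
qed

section \<open>Coincidences inside a block\<close>

text \<open>
  Coincidences $c (p, lp) + (x, mx) = c' (p', l'p') + (x', m'x')$.
\<close>

definition crossings ::
  "real set \<Rightarrow> real \<Rightarrow> real \<Rightarrow> real set \<Rightarrow> real \<Rightarrow> real \<Rightarrow> real \<Rightarrow> real set \<Rightarrow> real \<Rightarrow> ((real \<times> real) \<times> (real \<times> real)) set" where
  "crossings A p l X m p' l' X' m' = {((c, x), (c', x')). c \<in> A \<and> x \<in> X \<and> c' \<in> A \<and> x' \<in> X' \<and>
     c * p + x = c' * p' + x' \<and> l * (c * p) + m * x = l' * (c' * p') + m' * x'}"

lemma finite_crossings:
  assumes "finite A" "finite X" "finite X'"
  shows "finite (crossings A p l X m p' l' X' m')"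
  by (rule finite_subset[of _ "(A \<times> X) \<times> (A \<times> X')"]) (use assms in \<open>auto simp: crossings_def\<close>)

text \<open>The second coordinate minus l' (respectively l) times the first loses the term in c'
  (respectively c).\<close>

lemma crossings_eliminate:
  assumes "((c, x), (c', x')) \<in> crossings A p l X m p' l' X' m'"
  shows "(l' - l) * p * c + (l' - m) * x = (l' - m') * x'"
    and "(l - l') * p' * c' + (l - m') * x' = (l - m) * x"
proof -
  have e: "c * p + x = c' * p' + x'" "l * (c * p) + m * x = l' * (c' * p') + m' * x'"
    using assms by (auto simp: crossings_def)
  have "l' * (c * p + x) - (l * (c * p) + m * x) = l' * (c' * p' + x') - (l' * (c' * p') + m' * x')"
    by (simp only: e)
  then show "(l' - l) * p * c + (l' - m) * x = (l' - m') * x'" by (simp add: algebra_simps)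
  have "l * (c' * p' + x') - (l' * (c' * p') + m' * x') = l * (c * p + x) - (l * (c * p) + m * x)"
    by (simp only: e)
  then show "(l - l') * p' * c' + (l - m') * x' = (l - m) * x" by (simp add: algebra_simps)
qed

text \<open>Elimination gives (l - m) x = (l - m) x', so only diagonal coincidences remain.\<close>

lemma crossings_same:
  assumes "finite A" "finite X" "l \<noteq> m" "p \<noteq> 0"
  shows "card (crossings A p l X m p l X m) \<le> card A * card X"
proof -
  have "card (crossings A p l X m p l X m) \<le> card (A \<times> X)"
  proof (rule card_inj_on_le)
    show "inj_on fst (crossings A p l X m p l X m)"
    proof (rule inj_on_inverseI[where g = "\<lambda>i. (i, i)"])
      fix q assume q: "q \<in> crossings A p l X m p l X m"
      obtain c x c' x' where [simp]: "q = ((c, x), (c', x'))" by (metis surj_pair)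
      from crossings_eliminate(1)[OF q[simplified]] assms have "x = x'" by simp
      moreover from this q assms have "c = c'" by (auto simp: crossings_def)
      ultimately show "(fst q, fst q) = q" by simp
    qed
  qed (use assms in \<open>auto simp: crossings_def\<close>)
  then show ?thesis by (simp add: card_cartesian_product)
qed

text \<open>Two regimes. If X has at most 2n/\<kappa> elements, it suffices that (x, x') determines
  c and c'. If X is larger, (x, c) determines the rest and satisfies a linear condition with values
  in a dilate of X'; \<open>linear_form_solutions\<close> with U = X applies because AX is
  small.\<close>

lemma crossings_distinct:
  fixes \<kappa> :: real
  assumes fin: "finite A" "finite X" "finite X'" and X: "0 \<notin> X"
    and ne: "l \<noteq> l'" "l' \<noteq> m" "l' \<noteq> m'" and p: "p \<noteq> 0" "p' \<noteq> 0"
    and X': "card X' \<le> card A" and \<kappa>: "1 \<le> \<kappa>"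
    and prod: "real (card (prodset A X)) \<le> \<kappa> * real (card A)"
    and large: "512 * \<kappa> ^ 8 \<le> real (card A)"
  shows "real (card (crossings A p l X m p' l' X' m')) \<le> 2 * real (card A) / \<kappa> * (real (card X) + real (card X'))"
proof -
  define n where "n = real (card A)"
  define r where "r = real (card X)"
  define N where "N = real (card (crossings A p l X m p' l' X' m'))"
  have "\<kappa> ^ 8 \<ge> 1" using \<kappa> by simp
  then have n: "n > 0" "r \<ge> 0" using large unfolding n_def r_def by linarith+
  show ?thesis
  proof (cases "r \<le> 2 * n / \<kappa>")
    case True
    have "N \<le> real (card (X \<times> X'))" unfolding N_def
    proof (rule injection_card_le)
      let ?f = "\<lambda>((c::real, x::real), (c'::real, x'::real)). (x, x')"
      let ?g = "\<lambda>(x, x'). ((((l' - m') * x' - (l' - m) * x) / ((l' - l) * p), x),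
         (((l - m) * x - (l - m') * x') / ((l - l') * p'), x'))"
      show "inj_on ?f (crossings A p l X m p' l' X' m')"
      proof (rule inj_on_inverseI[where g = ?g])
        fix q assume q: "q \<in> crossings A p l X m p' l' X' m'"
        obtain c x c' x' where [simp]: "q = ((c, x), (c', x'))" by (metis surj_pair)
        note e = crossings_eliminate[OF q[simplified]]
        have "c = ((l' - m') * x' - (l' - m) * x) / ((l' - l) * p)"
          using e(1) ne p by (simp add: eq_divide_eq algebra_simps)
        moreover have "c' = ((l - m) * x - (l - m') * x') / ((l - l') * p')"
          using e(2) ne p by (simp add: eq_divide_eq algebra_simps)
        ultimately show "?g (?f q) = q" by simp
      qed
      show "?f ` crossings A p l X m p' l' X' m' \<subseteq> X \<times> X'" by (auto simp: crossings_def)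
    qed (use fin in auto)
    then have "N \<le> r * real (card X')" by (simp add: card_cartesian_product r_def)
    also have "\<dots> \<le> 2 * n / \<kappa> * real (card X')" using True by (intro mult_right_mono) auto
    also have "\<dots> \<le> 2 * n / \<kappa> * (r + real (card X'))" using n \<kappa> by (intro mult_left_mono) auto
    finally show ?thesis by (simp add: N_def n_def r_def)
  next
    case False
    then have rl: "n / \<kappa> < r" using n \<kappa> by (smt (verit) divide_less_cancel)
    have rp: "r > 0" using rl n \<kappa> by (smt (verit) divide_nonneg_nonneg)
    define B where "B = (\<lambda>x'. (l' - m') * x') ` X'"
    define \<alpha> where "\<alpha> = (l' - l) * p"
    define T where "T = {(x, c) \<in> X \<times> A. \<alpha> * c + (l' - m) * x \<in> B}"
    have finT: "finite T" unfolding T_def using fin by (auto intro: finite_subset[of _ "X \<times> A"])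
    have "N \<le> real (card T)" unfolding N_def
    proof (rule injection_card_le)
      let ?f = "\<lambda>((c::real, x::real), (c'::real, x'::real)). (x, c)"
      let ?x = "\<lambda>x c. (\<alpha> * c + (l' - m) * x) / (l' - m')"
      let ?g = "\<lambda>(x, c). ((c, x), ((c * p + x - ?x x c) / p', ?x x c))"
      show "inj_on ?f (crossings A p l X m p' l' X' m')"
      proof (rule inj_on_inverseI[where g = ?g])
        fix q assume q: "q \<in> crossings A p l X m p' l' X' m'"
        obtain c x c' x' where [simp]: "q = ((c, x), (c', x'))" by (metis surj_pair)
        note e = crossings_eliminate[OF q[simplified]]
        have x: "?x x c = x'" using e(1) ne by (simp add: \<alpha>_def)
        have "c * p + x = c' * p' + x'" using q by (simp add: crossings_def)
        then have "(c * p + x - x') / p' = c'" using p by (simp add: field_simps)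
        then show "?g (?f q) = q" by (simp add: x)
      qed
      show "?f ` crossings A p l X m p' l' X' m' \<subseteq> T"
      proof (rule image_subsetI)
        fix q assume q: "q \<in> crossings A p l X m p' l' X' m'"
        obtain c x c' x' where [simp]: "q = ((c, x), (c', x'))" by (metis surj_pair)
        note e = crossings_eliminate(1)[OF q[simplified]]
        then show "?f q \<in> T" using q by (auto simp: T_def B_def \<alpha>_def crossings_def)
      qed
    qed (rule finT)
    \<comment> \<open>The threshold for a typical x. Since n = k \<kappa>, the hypothesis
      \<open>large\<close> says 512 \<kappa>^7 \<le> k, which absorbs the error: at most k r pairs
      come beyond the trivial k r.\<close>
    define k where "k = n / \<kappa>"
    have k: "8 \<le> k" "k > 0"
    proof -
      have "8 * \<kappa> \<le> 512 * \<kappa> ^ 8" using \<kappa> self_le_power[of \<kappa> 8] by linarith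
      then show "8 \<le> k" using large \<kappa> by (simp add: k_def n_def field_simps)
      then show "k > 0" by simp
    qed
    have nk: "n = k * \<kappa>" using \<kappa> by (simp add: k_def)
    have "card B \<le> card X'" unfolding B_def by (rule card_image_le[OF fin(3)])
    then have cB: "real (card B) \<le> n" using X' by (simp add: n_def)
    have "r * (real (card T) - k * r) * k ^ 3 \<le> 512 * n * (real (card (prodset A X)))\<^sup>2 * (real (card B))\<^sup>2"
      unfolding r_def T_def n_def
      by (rule linear_form_solutions) (use fin X k ne p in \<open>auto simp: B_def \<alpha>_def\<close>)
    also have "\<dots> \<le> 512 * n * (\<kappa> * n)\<^sup>2 * n\<^sup>2"
      using prod cB n \<kappa> by (intro mult_mono power_mono) (auto simp: n_def)
    also have "\<dots> = (512 * \<kappa> ^ 7 * k\<^sup>2) * k ^ 3" by (simp add: nk eval_nat_numeral)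
    finally have "r * (real (card T) - k * r) \<le> 512 * \<kappa> ^ 7 * k\<^sup>2"
      by (rule mult_right_le_imp_le) (use k in simp)
    also have "\<dots> \<le> k ^ 3"
    proof -
      have "512 * \<kappa> ^ 7 * \<kappa> \<le> k * \<kappa>" using large nk by (simp add: n_def eval_nat_numeral)
      then have "512 * \<kappa> ^ 7 \<le> k" by (rule mult_right_le_imp_le) (use \<kappa> in simp)
      then have "512 * \<kappa> ^ 7 * k\<^sup>2 \<le> k * k\<^sup>2" by (intro mult_right_mono) auto
      then show ?thesis by (simp add: eval_nat_numeral)
    qed
    also have "\<dots> \<le> r * (k * r)"
    proof -
      have "k\<^sup>2 \<le> r\<^sup>2" using rl k by (intro power_mono) (auto simp: k_def)
      then have "k * k\<^sup>2 \<le> k * r\<^sup>2" using k by (intro mult_left_mono) auto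
      then show ?thesis by (simp add: eval_nat_numeral mult_ac)
    qed
    finally have "real (card T) - k * r \<le> k * r" by (rule mult_left_le_imp_le) (use rp in simp)
    then have "N \<le> 2 * n / \<kappa> * r" using \<open>N \<le> real (card T)\<close> by (simp add: k_def)
    also have "\<dots> \<le> 2 * n / \<kappa> * (r + real (card X'))" using n \<kappa> by (intro mult_left_mono) auto
    finally show ?thesis by (simp add: N_def n_def r_def)
  qed
qed

text \<open>For equal l, (x, c) determines x' = \<theta> x and c' = c + \<eta> x, so the count is at
  most the sum over x of the representations of \<eta> x as a difference of A. Unpopular x give
  n/\<kappa> each; the popular ones are few by \<open>popular_dilates_bounded\<close>.\<close>

lemma crossings_parallel:
  fixes \<kappa> :: real
  assumes fin: "finite A" "finite X" and X: "0 \<notin> X"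
    and ne: "m \<noteq> m'" "l \<noteq> m" "l \<noteq> m'" and p: "p \<noteq> 0" and \<kappa>: "1 \<le> \<kappa>"
    and prod: "real (card (prodset A X)) \<le> \<kappa> * real (card A)"
    and rich: "real (card A) \<le> (real (card X))\<^sup>2 * \<kappa>\<^sup>2"
    and large: "2 ^ 138 * \<kappa> ^ 148 < real (card A)"
  shows "real (card (crossings A p l X m p l X' m')) \<le> 2 * real (card A) / \<kappa> * real (card X)"
proof -
  define n where "n = real (card A)"
  define r where "r = real (card X)"
  define \<theta> where "\<theta> = (l - m) / (l - m')"
  define \<eta> where "\<eta> = (1 - \<theta>) / p"
  have n: "n > 0" using large \<kappa> unfolding n_def by (smt (verit) mult_nonneg_nonneg zero_le_power)
  have "\<theta> \<noteq> 1" using ne by (simp add: \<theta>_def)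
  then have \<eta>0: "\<eta> \<noteq> 0" using p by (simp add: \<eta>_def)
  define T where "T = (SIGMA x : X. {c \<in> A. c + \<eta> * x \<in> A})"
  have finT: "finite T" unfolding T_def using fin by auto
  have det: "x' = \<theta> * x" "c' = c + \<eta> * x"
    if "((c, x), (c', x')) \<in> crossings A p l X m p l X' m'" for c x c' x'
  proof -
    have e: "(l - m) * x = (l - m') * x'" using crossings_eliminate(1)[OF that] by simp
    then show x': "x' = \<theta> * x" using ne by (simp add: \<theta>_def field_simps)
    have "c * p + x = c' * p + x'" using that by (simp add: crossings_def)
    then show "c' = c + \<eta> * x" unfolding x' \<eta>_def using p by (simp add: field_simps)
  qed
  have "real (card (crossings A p l X m p l X' m')) \<le> real (card T)"
  proof (rule injection_card_le)
    let ?f = "\<lambda>((c::real, x::real), (c'::real, x'::real)). (x, c)"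
    let ?g = "\<lambda>(x, c). ((c, x), (c + \<eta> * x, \<theta> * x))"
    show "inj_on ?f (crossings A p l X m p l X' m')"
    proof (rule inj_on_inverseI[where g = ?g])
      fix q assume q: "q \<in> crossings A p l X m p l X' m'"
      obtain c x c' x' where [simp]: "q = ((c, x), (c', x'))" by (metis surj_pair)
      from det[OF q[simplified]] show "?g (?f q) = q" by simp
    qed
    show "?f ` crossings A p l X m p l X' m' \<subseteq> T"
    proof (rule image_subsetI)
      fix q assume q: "q \<in> crossings A p l X m p l X' m'"
      obtain c x c' x' where [simp]: "q = ((c, x), (c', x'))" by (metis surj_pair)
      from det[OF q[simplified]] q show "?f q \<in> T" by (auto simp: T_def crossings_def)
    qed
  qed (rule finT)
  also have "real (card T) = (\<Sum>x\<in>X. real (diff_reps A (\<eta> * x)))"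
    unfolding T_def diff_reps_def using fin by simp
  also have "\<dots> \<le> 2 * n / \<kappa> * r"
  proof -
    define V where "V = {x \<in> X. n / \<kappa> \<le> real (diff_reps A (\<eta> * x))}"
    have finV: "finite V" unfolding V_def using fin by simp
    have "(\<Sum>x\<in>X. real (diff_reps A (\<eta> * x))) \<le> (\<Sum>x\<in>X. n / \<kappa> + (if x \<in> V then n else 0))"
    proof (rule sum_mono)
      fix x assume "x \<in> X"
      then show "real (diff_reps A (\<eta> * x)) \<le> n / \<kappa> + (if x \<in> V then n else 0)"
        using diff_reps_le[OF fin(1), of "\<eta> * x"] n \<kappa>
        by (auto simp: V_def n_def intro: add_increasing)
    qed
    also have "\<dots> = n / \<kappa> * r + real (card V) * n"
    proof -
      have "X \<inter> V = V" by (auto simp: V_def)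
      then show ?thesis using fin by (simp add: sum.distrib sum.If_cases r_def)
    qed
    finally have sum_le: "(\<Sum>x\<in>X. real (diff_reps A (\<eta> * x))) \<le> n / \<kappa> * r + real (card V) * n" .
    \<comment> \<open>If V had more than r/\<kappa> elements, \<open>rich\<close> would give n \<le>
      |V|^2 \<kappa>^4. Together with |V| \<le> 2^69 \<kappa>^72 this contradicts
      \<open>large\<close>.\<close>
    have "real (card V) \<le> r / \<kappa>"
    proof (rule ccontr)
      assume "\<not> real (card V) \<le> r / \<kappa>"
      then have "r \<le> real (card V) * \<kappa>" using \<kappa> by (simp add: field_simps)
      then have "r\<^sup>2 * \<kappa>\<^sup>2 \<le> (real (card V) * \<kappa>)\<^sup>2 * \<kappa>\<^sup>2"
        using \<kappa> by (intro mult_right_mono power_mono) (auto simp: r_def)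
      then have small: "n \<le> (real (card V))\<^sup>2 * \<kappa> ^ 4"
        using rich by (simp add: n_def r_def power_mult_distrib eval_nat_numeral mult_ac)
      have "prodset A V \<subseteq> prodset A X" unfolding V_def prodset_def by auto
      then have "card (prodset A V) \<le> card (prodset A X)" using fin by (intro card_mono) auto
      then have prodV: "real (card (prodset A V)) \<le> \<kappa> * n" using prod by (simp add: n_def)
      have "16 * \<kappa>\<^sup>2 \<le> 2 ^ 138 * \<kappa> ^ 148" using \<kappa> by (intro mult_mono power_increasing) auto
      then have "16 * \<kappa>\<^sup>2 \<le> n" using large by (simp add: n_def)
      have "real (card V) \<le> 2 ^ 69 * \<kappa> ^ 72"
      proof (rule popular_dilates_bounded)
        show "A \<noteq> {}" using n by (auto simp: n_def)
        show "real (card A) / \<kappa> \<le> real (diff_reps A (\<eta> * x))" if "x \<in> V" for x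
          using that by (simp add: V_def n_def)
      qed (use fin finV X \<eta>0 \<kappa> prodV \<open>16 * \<kappa>\<^sup>2 \<le> n\<close> small in \<open>auto simp: n_def V_def\<close>)
      then have "(real (card V))\<^sup>2 * \<kappa> ^ 4 \<le> (2 ^ 69 * \<kappa> ^ 72)\<^sup>2 * \<kappa> ^ 4"
        using \<kappa> by (intro mult_right_mono power_mono) auto
      also have "\<dots> = 2 ^ 138 * \<kappa> ^ 148" by (simp add: power_mult_distrib flip: power_mult power_add)
      finally show False using small large by (simp add: n_def)
    qed
    then have "real (card V) * n \<le> r / \<kappa> * n" using n by (intro mult_right_mono) auto
    moreover have "2 * n / \<kappa> * r = n / \<kappa> * r + r / \<kappa> * n" by (simp add: field_simps)
    ultimately show ?thesis using sum_le by linarith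
  qed
  finally show ?thesis by (simp add: n_def r_def)
qed

text \<open>The block has M n y parameters, where y is the weight of H. Diagonal pairs of slopes
  give M n y coincidences. In the sum over the M^4 pairs (l, m), (l', m') the factor 1/M^2 of
  \<open>cross\<close> leaves 2 M n y more. Cauchy-Schwarz then yields one third of the number of
  parameters.\<close>

lemma crossing_block:
  fixes L H A :: "real set" and a :: "real \<Rightarrow> real" and X :: "real \<Rightarrow> real set" and M :: nat
  assumes fin: "finite L" "finite H" "finite A" "\<And>m. m \<in> H \<Longrightarrow> finite (X m)"
    and card: "card L = M" "card H = M" "M > 0" and disj: "L \<inter> H = {}"
    and a: "\<And>l. l \<in> L \<Longrightarrow> a l \<noteq> 0"
    and cross: "\<And>l m l' m'. l \<in> L \<Longrightarrow> l' \<in> L \<Longrightarrow> m \<in> H \<Longrightarrow> m' \<in> H \<Longrightarrow> (l, m) \<noteq> (l', m') \<Longrightarrow>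
      real (card (crossings A (a l) l (X m) m (a l') l' (X m') m')) \<le>
        real (card A) / (real M)\<^sup>2 * (real (card (X m)) + real (card (X m')))"
  shows "real M * real (card A) * (\<Sum>m\<in>H. real (card (X m))) / 3 \<le>
    real (card ((\<lambda>(l, m, c, x). (c * a l + x, l * (c * a l) + m * x)) ` (L \<times> (SIGMA m : H. A \<times> X m))))"
proof -
  define n where "n = real (card A)"
  define y where "y = (\<Sum>m\<in>H. real (card (X m)))"
  define F where "F = (\<lambda>(l, m, c, x). (c * a l + x, l * (c * a l) + m * x))"
  define J where "J = L \<times> (SIGMA m : H. A \<times> X m)"
  define E where "E = {(i, j). i \<in> J \<and> j \<in> J \<and> F i = F j}"
  define C where "C i j = crossings A (a (fst i)) (fst i) (X (snd i)) (snd i) (a (fst j)) (fst j) (X (snd j)) (snd j)" for i j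
  define r where "r i = real (card (X (snd i)))" for i :: "real \<times> real"
  let ?P = "L \<times> H"
  have finJ: "finite J" unfolding J_def using fin by auto
  have cJ: "real (card J) = real M * n * y"
    unfolding J_def using fin card by (simp add: card_cartesian_product n_def y_def sum_distrib_left mult_ac)
  have finC: "finite (C i j)" if "i \<in> ?P" "j \<in> ?P" for i j
    unfolding C_def using fin that by (intro finite_crossings) auto
  have "real (card E) \<le> real (card (SIGMA i : ?P. SIGMA j : ?P. C i j))"
  proof (rule injection_card_le)
    let ?f = "\<lambda>((l::real, m::real, c::real, x::real), (l'::real, m'::real, c'::real, x'::real)).
       ((l, m), (l', m'), ((c, x), (c', x')))"
    show "inj_on ?f E" by (auto simp: inj_on_def)
    show "?f ` E \<subseteq> (SIGMA i : ?P. SIGMA j : ?P. C i j)"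
      unfolding E_def J_def F_def C_def crossings_def by auto
    show "finite (SIGMA i : ?P. SIGMA j : ?P. C i j)"
      using fin finC by (intro finite_SigmaI) auto
  qed
  also have "\<dots> = (\<Sum>i\<in>?P. \<Sum>j\<in>?P. real (card (C i j)))"
    using fin finC by simp
  also have "\<dots> \<le> (\<Sum>i\<in>?P. \<Sum>j\<in>?P. (if i = j then n * r i else 0) + n / (real M)\<^sup>2 * (r i + r j))"
  proof (intro sum_mono)
    fix i j assume ij: "i \<in> ?P" "j \<in> ?P"
    show "real (card (C i j)) \<le> (if i = j then n * r i else 0) + n / (real M)\<^sup>2 * (r i + r j)"
    proof (cases "i = j")
      case True
      have "card (C i j) \<le> card A * card (X (snd i))"
        unfolding C_def True[symmetric] by (rule crossings_same) (use ij fin a disj in auto)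
      then have "real (card (C i j)) \<le> real (card A * card (X (snd i)))" by (simp only: of_nat_le_iff)
      then show ?thesis using True by (simp add: n_def r_def add_increasing2)
    next
      case False
      then show ?thesis using cross[of "fst i" "fst j" "snd i" "snd j"] ij
        by (auto simp: C_def n_def r_def)
    qed
  qed
  also have "\<dots> = 3 * (real M * n * y)"
  proof -
    have ry: "(\<Sum>i\<in>?P. r i) = real M * y"
    proof -
      have "(\<Sum>i\<in>?P. r i) = (\<Sum>l\<in>L. \<Sum>m\<in>H. real (card (X m)))"
        unfolding r_def sum.cartesian_product by (simp add: case_prod_beta)
      then show ?thesis using card by (simp add: y_def)
    qed
    have "(\<Sum>i\<in>?P. \<Sum>j\<in>?P. (if i = j then n * r i else 0)) = n * (real M * y)"
      using fin by (simp add: ry flip: sum_distrib_left)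
    moreover have "(\<Sum>i\<in>?P. \<Sum>j\<in>?P. n / (real M)\<^sup>2 * (r i + r j)) = n / (real M)\<^sup>2 * (2 * (real M)\<^sup>2 * (real M * y))"
    proof -
      have "(\<Sum>i\<in>?P. \<Sum>j\<in>?P. r i + r j) = (\<Sum>i\<in>?P. (real M)\<^sup>2 * r i + real M * y)"
        using card by (simp add: ry sum.distrib card_cartesian_product power2_eq_square)
      also have "\<dots> = 2 * (real M)\<^sup>2 * (real M * y)"
        using card by (simp add: ry sum.distrib card_cartesian_product power2_eq_square flip: sum_distrib_left)
      finally show ?thesis by (simp only: sum_distrib_left[symmetric])
    qed
    ultimately show ?thesis using card by (simp add: sum.distrib)
  qed
  finally have E: "real (card E) \<le> 3 * (real M * n * y)" .
  have "(real M * n * y)\<^sup>2 \<le> real (card (F ` J)) * real (card E)"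
    unfolding cJ[symmetric] E_def by (rule card_square_le_collisions[OF finJ])
  also have "\<dots> \<le> real (card (F ` J)) * (3 * (real M * n * y))" using E by (intro mult_left_mono) auto
  finally have *: "real M * n * y * (real M * n * y) \<le> real (card (F ` J)) * 3 * (real M * n * y)"
    by (simp add: power2_eq_square mult_ac)
  have "real M * n * y \<ge> 0" by (simp add: n_def y_def sum_nonneg)
  then have "real M * n * y \<le> real (card (F ` J)) * 3"
  proof (cases "real M * n * y = 0")
    case False
    with \<open>real M * n * y \<ge> 0\<close> have "real M * n * y > 0" by linarith
    with * show ?thesis by (rule mult_right_le_imp_le)
  next
    case True
    show ?thesis unfolding True by simp
  qed
  then show ?thesis unfolding n_def y_def F_def J_def by simp
qed

section \<open>The three kinds of slopes\<close>

lemma AA_plus_AI: "a \<in> A \<Longrightarrow> b \<in> A \<Longrightarrow> c \<in> A \<Longrightarrow> a * b + c \<in> AA_plus_A A"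
  unfolding AA_plus_A_def by blast

lemma finite_AA_plus_A:
  assumes "finite A"
  shows "finite (AA_plus_A A)"
proof -
  have "AA_plus_A A \<subseteq> (\<lambda>(a, b, c). a * b + c) ` (A \<times> A \<times> A)"
    unfolding AA_plus_A_def by force
  then show ?thesis using assms finite_subset by blast
qed

section \<open>The points of A x A sorted by slope\<close>

definition slope_fibre :: "real set \<Rightarrow> real \<Rightarrow> real set" where
  "slope_fibre A l = {x \<in> A. l * x \<in> A}"

definition ratios :: "real set \<Rightarrow> real set" where
  "ratios A = (\<lambda>(b, a). b / a) ` (A \<times> A)"

lemma finite_slope_fibre [simp]: "finite A \<Longrightarrow> finite (slope_fibre A l)"
  by (simp add: slope_fibre_def)

lemma finite_ratios [simp]: "finite A \<Longrightarrow> finite (ratios A)"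
  by (simp add: ratios_def)

lemma card_slope_fibre_le: "finite A \<Longrightarrow> card (slope_fibre A l) \<le> card A"
  unfolding slope_fibre_def by (intro card_mono) auto

lemma slope_fibre_nonempty:
  assumes "\<forall>a\<in>A. a > 0" "l \<in> ratios A"
  shows "slope_fibre A l \<noteq> {}"
proof -
  obtain a b where "a \<in> A" "b \<in> A" "l = b / a" using assms unfolding ratios_def by auto
  moreover from this assms have "l * a = b" by (auto simp: less_imp_neq[symmetric])
  ultimately show ?thesis unfolding slope_fibre_def by auto
qed

text \<open>The rays through the origin partition A x A; x in the fibre of l stands for the point
  (x, l x).\<close>

lemma sum_slope_fibres:
  assumes "finite A" "\<forall>a\<in>A. a > 0"
  shows "(\<Sum>l\<in>ratios A. real (card (slope_fibre A l))) = (real (card A))\<^sup>2"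
proof -
  have "bij_betw (\<lambda>(l, x). (x, l * x)) (SIGMA l : ratios A. slope_fibre A l) (A \<times> A)"
    by (rule bij_betwI[where g = "\<lambda>(a, b). (b / a, a)"])
       (use assms in \<open>auto simp: slope_fibre_def ratios_def less_imp_neq[symmetric] dest: less_imp_neq\<close>)
  then have "card (SIGMA l : ratios A. slope_fibre A l) = card (A \<times> A)"
    by (rule bij_betw_same_card)
  then have "(\<Sum>l\<in>ratios A. card (slope_fibre A l)) = card A * card A"
    using assms by (simp add: card_cartesian_product)
  then show ?thesis by (metis of_nat_mult of_nat_sum power2_eq_square)
qed

text \<open>The exponent comes from \<open>crossings_parallel\<close> with \<kappa> = 2 M^2: there n
  must exceed 2^138 \<kappa>^148 = 2^286 M^296.\<close>

locale large_positive_set =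
  fixes A :: "real set" and M :: nat
  assumes fin: "finite A" and pos: "\<forall>a\<in>A. a > 0" and M: "M > 0"
    and large: "(2 * M) ^ 300 \<le> card A"
begin

definition n :: real where "n = real (card A)"
abbreviation S where "S \<equiv> AA_plus_A A"
abbreviation X where "X \<equiv> slope_fibre A"
definition r :: "real \<Rightarrow> real" where "r l = real (card (X l))"
definition u :: "real \<Rightarrow> real" where "u l = (SOME x. x \<in> X l)" \<comment> \<open>meaningful only for \<open>l \<in> ratios A\<close>\<close>

lemma n_large: "k \<le> 300 \<Longrightarrow> j \<le> 300 \<Longrightarrow> 2 ^ k * real M ^ j \<le> n"
proof -
  assume "k \<le> 300" "j \<le> 300"
  then have "2 ^ k * real M ^ j \<le> 2 ^ 300 * real M ^ 300"
    using M by (intro mult_mono power_increasing) auto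
  also have "\<dots> = real ((2 * M) ^ 300)" by (simp add: power_mult_distrib)
  also have "\<dots> \<le> n" using large unfolding n_def by (simp only: of_nat_le_iff)
  finally show ?thesis .
qed

lemma n_ge: "1024 * real M \<le> n" "1024 \<le> n" "1 \<le> real M"
  using n_large[of 10 1] M by simp_all

lemma r_le: "r l \<le> n"
  using card_slope_fibre_le[OF fin] by (simp add: r_def n_def)

lemma u_in: "l \<in> ratios A \<Longrightarrow> u l \<in> X l"
  using slope_fibre_nonempty[OF pos] unfolding u_def by (simp add: some_in_eq)

lemma X_pos: "x \<in> X l \<Longrightarrow> x > 0"
  using pos by (simp add: slope_fibre_def)

lemma sum_point_in_S:
  assumes "c \<in> A" "v \<in> X l" "x \<in> X m"
  shows "c * v + x \<in> S" "l * (c * v) + m * x \<in> S"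
proof -
  show "c * v + x \<in> S" using assms by (auto simp: slope_fibre_def intro: AA_plus_AI)
  have "c * (l * v) + m * x \<in> S" using assms by (auto simp: slope_fibre_def intro: AA_plus_AI)
  then show "l * (c * v) + m * x \<in> S" by (simp add: mult_ac)
qed

text \<open>Each ray is short, so there are at least M n^(3/2) / 3 slopes, and one representative
  point per ray is enough. All slopes get weight 1 in the packing; a block of s slopes gains s^2 n /
  3 sums, that is s n / 3 per slope.\<close>

lemma poor_slopes:
  assumes \<Lambda>: "\<Lambda> \<subseteq> ratios A" and r: "\<And>l. l \<in> \<Lambda> \<Longrightarrow> r l \<le> sqrt n / real M"
    and big: "n\<^sup>2 / 3 \<le> sum r \<Lambda>"
  shows "real M * n ^ 3 / 100 \<le> (real (card S))\<^sup>2"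
proof -
  define q where "q = sqrt n"
  \<comment> \<open>The largest block size with s^2 \<le> n, the condition of
    \<open>parallel_segments_block\<close>.\<close>
  define s where "s = nat \<lfloor>q\<rfloor>"
  have q2: "n = q\<^sup>2" and q: "q \<ge> 2"
    using n_ge by (auto simp: q_def intro: real_le_rsqrt)
  have s: "real s \<le> q" "q / 2 \<le> real s" "s > 0" using q unfolding s_def by linarith+
  have fin\<Lambda>: "finite \<Lambda>" using \<Lambda> fin finite_subset finite_ratios by blast
  have "real s * n / 3 * (sum (\<lambda>_. 1) \<Lambda> - real s * 1) \<le> (real (card S))\<^sup>2"
  proof (rule cone_packing)
    fix I assume I: "I \<subseteq> \<Lambda>" "card I = s"
    have uI: "u l \<in> X l" if "l \<in> I" for l using that I \<Lambda> u_in by blast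
    let ?Z = "(\<lambda>(l, m, c). (c * u l + u m, l * (c * u l) + m * u m)) ` (I \<times> I \<times> A)"
    have "(real s)\<^sup>2 \<le> q\<^sup>2" using s by (intro power_mono) auto
    then have "real (s\<^sup>2) \<le> real (card A)" using q2 by (simp add: n_def)
    then have ss: "(card I)\<^sup>2 \<le> card A" using I by (simp only: of_nat_le_iff)
    have "(real (card I))\<^sup>2 * real (card A) / 3 \<le> real (card ?Z)"
    proof (rule parallel_segments_block)
      show "finite I" using I fin\<Lambda> finite_subset by auto
      show "I \<noteq> {}" using I s by auto
      show "A \<noteq> {}" using n_ge by (auto simp: n_def)
    qed (use fin uI X_pos ss in auto)
    then have "real s * n / 3 * sum (\<lambda>_. 1) I \<le> real (card ?Z)"
      using I by (simp add: n_def power2_eq_square mult_ac)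
    moreover have "?Z \<subseteq> S \<times> S" by (auto intro: sum_point_in_S[OF _ uI uI])
    moreover have "in_cone I ?Z"
    proof (rule in_cone_sums)
      fix z assume "z \<in> ?Z"
      then obtain l m c where *: "l \<in> I" "m \<in> I" "c \<in> A" "z = (c * u l + u m, l * (c * u l) + m * u m)"
        by auto
      moreover have "c * u l > 0" "u m > 0" using *(1-3) X_pos[OF uI] pos by simp_all
      ultimately show "\<exists>l\<in>I. \<exists>m\<in>I. \<exists>x>0. \<exists>y>0. z = (x + y, l * x + m * y)" by blast
    qed
    ultimately show "\<exists>Z\<subseteq>S \<times> S. in_cone I Z \<and> real s * n / 3 * sum (\<lambda>_. 1) I \<le> real (card Z)" by blast
  qed (use fin\<Lambda> fin s finite_AA_plus_A in \<open>auto simp: n_def\<close>)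
  then have pack: "real s * n / 3 * (real (card \<Lambda>) - real s) \<le> (real (card S))\<^sup>2" by simp
  have "q ^ 4 / 3 \<le> sum r \<Lambda>" using big by (simp add: q2 flip: power_mult)
  also have "\<dots> \<le> real (card \<Lambda>) * (q / real M)" using r unfolding q_def by (intro sum_bounded_above) auto
  finally have "q * (real M * q ^ 3 / 3) \<le> q * real (card \<Lambda>)"
    using M by (simp add: field_simps eval_nat_numeral)
  then have c\<Lambda>: "real M * q ^ 3 / 3 \<le> real (card \<Lambda>)" by (rule mult_left_le_imp_le) (use q in simp)
  \<comment> \<open>The at most s \<le> q slopes lost in the packing are at most half of the
    available M q^3 / 3.\<close>
  have "q * 6 \<le> q * (real M * q\<^sup>2)"
  proof (intro mult_left_mono)
    have "1 * n \<le> real M * n" using n_ge by (intro mult_right_mono) auto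
    then show "6 \<le> real M * q\<^sup>2" using n_ge unfolding q2[symmetric] by linarith
  qed (use q in auto)
  then have "q \<le> real M * q ^ 3 / 6" by (simp add: eval_nat_numeral mult_ac)
  then have "real M * q ^ 3 / 6 \<le> real (card \<Lambda>) - real s" using c\<Lambda> s by linarith
  then have "q / 2 * n / 3 * (real M * q ^ 3 / 6) \<le> real s * n / 3 * (real (card \<Lambda>) - real s)"
    using s n_ge q by (intro mult_mono divide_right_mono) auto
  moreover have "q / 2 * n / 3 * (real M * q ^ 3 / 6) = real M * n ^ 3 / 36"
    by (simp add: q2 eval_nat_numeral)
  moreover have "real M * n ^ 3 \<ge> 0" using n_ge by simp
  ultimately show ?thesis using pack by linarith
qed

text \<open>Two slopes per block. Sums of a vector of slope l and one of slope m are all distinct,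
  and each fibre product has at least M n elements instead of the n dilates of a single
  point.\<close>

lemma expanding_slopes:
  assumes \<Lambda>: "\<Lambda> \<subseteq> ratios A" and ex: "\<And>l. l \<in> \<Lambda> \<Longrightarrow> real M * n \<le> real (card (prodset A (X l)))"
    and big: "n\<^sup>2 / 3 \<le> sum r \<Lambda>"
  shows "real M * n ^ 3 / 100 \<le> (real (card S))\<^sup>2"
proof -
  have fin\<Lambda>: "finite \<Lambda>" using \<Lambda> fin finite_subset finite_ratios by blast
  have "real M * n / 2 * (sum r \<Lambda> - real 2 * n) \<le> (real (card S))\<^sup>2"
  proof (rule cone_packing)
    fix I assume I: "I \<subseteq> \<Lambda>" "card I = 2"
    \<comment> \<open>Products are formed on the lighter ray l, so \<open>r m\<close> is at least
      half of the weight of the pair.\<close>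
    then obtain l m where lm: "I = {l, m}" "l \<noteq> m" "r l \<le> r m"
      by (metis card_2_iff doubleton_eq_iff linorder_linear)
    let ?f = "\<lambda>(z, x). (z + x, l * z + m * x)"
    let ?Z = "?f ` (prodset A (X l) \<times> X m)"
    have "inj_on ?f (prodset A (X l) \<times> X m)"
    proof (rule inj_onI, clarify)
      fix z x z' x' :: real assume e: "z + x = z' + x'" "l * z + m * x = l * z' + m * x'"
      then have "l * z + m * x - l * (z + x) = l * z' + m * x' - l * (z' + x')" by simp
      then have "(m - l) * (x - x') = 0" by (simp add: algebra_simps)
      then show "z = z' \<and> x = x'" using lm e by simp
    qed
    then have "real (card ?Z) = real (card (prodset A (X l))) * r m"
      by (simp add: card_image card_cartesian_product r_def)
    moreover have "real M * n * r m \<le> real (card (prodset A (X l))) * r m"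
      using ex[of l] lm I by (intro mult_right_mono) (auto simp: r_def)
    moreover have "real M * n / 2 * sum r I \<le> real M * n / 2 * (2 * r m)"
      using lm n_ge by (intro mult_left_mono) auto
    ultimately have "real M * n / 2 * sum r I \<le> real (card ?Z)" by simp
    moreover have "?Z \<subseteq> S \<times> S" using sum_point_in_S by (auto simp: prodset_def)
    moreover have "in_cone I ?Z"
    proof (rule in_cone_sums)
      fix z assume "z \<in> ?Z"
      then obtain c v x where *: "c \<in> A" "v \<in> X l" "x \<in> X m" "z = (c * v + x, l * (c * v) + m * x)"
        unfolding prodset_def by auto
      moreover have "c * v > 0" "x > 0" using * X_pos pos by auto
      ultimately show "\<exists>l\<in>I. \<exists>m\<in>I. \<exists>x>0. \<exists>y>0. z = (x + y, l * x + m * y)" using lm by blast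
    qed
    ultimately show "\<exists>Z\<subseteq>S \<times> S. in_cone I Z \<and> real M * n / 2 * sum r I \<le> real (card Z)" by blast
  qed (use fin\<Lambda> fin finite_AA_plus_A r_le n_ge in auto)
  moreover have "real M * n / 2 * (n\<^sup>2 / 6) \<le> real M * n / 2 * (sum r \<Lambda> - real 2 * n)"
  proof (intro mult_left_mono)
    have "1024 * n \<le> n * n" using n_ge by (intro mult_right_mono) auto
    then show "n\<^sup>2 / 6 \<le> sum r \<Lambda> - real 2 * n" using big n_ge(2) unfolding power2_eq_square of_nat_numeral by linarith
  qed (use n_ge in auto)
  moreover have "real M * n / 2 * (n\<^sup>2 / 6) = real M * n ^ 3 / 12" by (simp add: eval_nat_numeral)
  moreover have "real M * n ^ 3 \<ge> 0" using n_ge by simp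
  ultimately show ?thesis by linarith
qed

lemma structured_crossings:
  assumes l: "l \<in> ratios A" "l' \<in> ratios A" and ne: "l \<noteq> m" "l \<noteq> m'" "l' \<noteq> m" "l' \<noteq> m'"
    and prod: "real (card (prodset A (X m))) \<le> real M * n"
    and rich: "sqrt n / real M \<le> r m" and d: "(l, m) \<noteq> (l', m')"
  shows "real (card (crossings A (u l) l (X m) m (u l') l' (X m') m')) \<le>
    n / (real M)\<^sup>2 * (r m + r m')"
proof -
  \<comment> \<open>With this value the bound 2n/\<kappa> of the two crossing estimates becomes the
    n/M^2 that \<open>crossing_block\<close> needs.\<close>
  define \<kappa> where "\<kappa> = 2 * (real M)\<^sup>2"
  have "real M * 1 \<le> real M * real M" using n_ge by (intro mult_left_mono) auto
  then have \<kappa>: "1 \<le> \<kappa>" "real M \<le> \<kappa>" using n_ge unfolding \<kappa>_def power2_eq_square by linarith+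
  have "real M * n \<le> \<kappa> * n" using \<kappa> n_ge by (intro mult_right_mono) auto
  then have prod': "real (card (prodset A (X m))) \<le> \<kappa> * real (card A)" using prod by (simp add: n_def)
  have u: "u l \<noteq> 0" "u l' \<noteq> 0" using l u_in X_pos by fastforce+
  have X0: "0 \<notin> X m" using X_pos by blast
  have eps: "2 * n / \<kappa> = n / (real M)\<^sup>2" by (simp add: \<kappa>_def)
  show ?thesis
  proof (cases "l = l'")
    case False
    have "512 * \<kappa> ^ 8 = 2 ^ 17 * real M ^ 16" by (simp add: \<kappa>_def power_mult_distrib flip: power_mult)
    then have "512 * \<kappa> ^ 8 \<le> real (card A)" using n_large[of 17 16] by (simp add: n_def)
    then show ?thesis unfolding n_def r_def eps[unfolded n_def, symmetric]
      by (intro crossings_distinct) (use fin X0 False ne u \<kappa> prod' card_slope_fibre_le in auto)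
  next
    case True
    have "sqrt n \<le> r m * real M" using rich n_ge by (simp add: field_simps)
    also have "\<dots> \<le> r m * \<kappa>" using \<kappa> by (intro mult_left_mono) (auto simp: r_def)
    finally have "(sqrt n)\<^sup>2 \<le> (r m * \<kappa>)\<^sup>2" using n_ge by (intro power_mono) auto
    then have rich': "real (card A) \<le> (real (card (X m)))\<^sup>2 * \<kappa>\<^sup>2"
      by (simp add: n_def r_def power_mult_distrib)
    have "2 ^ 138 * \<kappa> ^ 148 = 2 ^ 286 * real M ^ 296"
      by (simp add: \<kappa>_def power_mult_distrib flip: power_mult)
    also have "\<dots> < 2 ^ 287 * real M ^ 296" using M by simp
    also have "\<dots> \<le> real (card A)" using n_large[of 287 296] by (simp add: n_def)
    finally have large': "2 ^ 138 * \<kappa> ^ 148 < real (card A)" .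
    have "real (card (crossings A (u l) l (X m) m (u l') l' (X m') m')) \<le> 2 * real (card A) / \<kappa> * real (card (X m))"
      unfolding True[symmetric]
      by (rule crossings_parallel) (use fin X0 d True ne u \<kappa> prod' rich' large' in auto)
    also have "\<dots> = n / (real M)\<^sup>2 * r m" using eps by (simp add: n_def r_def)
    also have "\<dots> \<le> n / (real M)\<^sup>2 * (r m + r m')" using n_ge by (intro mult_left_mono) (auto simp: r_def)
    finally show ?thesis .
  qed
qed

text \<open>A block of 2M slopes is split into halves L and H. Rays in L contribute one point each,
  dilated by A; rays in H contribute all their points. Disjointness of L and H supplies the
  inequalities between slopes in \<open>structured_crossings\<close>.\<close>

lemma structured_slopes:
  assumes \<Lambda>: "\<Lambda> \<subseteq> ratios A"
    and prod: "\<And>l. l \<in> \<Lambda> \<Longrightarrow> real (card (prodset A (X l))) \<le> real M * n"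
    and rich: "\<And>l. l \<in> \<Lambda> \<Longrightarrow> sqrt n / real M \<le> r l"
    and big: "n\<^sup>2 / 3 \<le> sum r \<Lambda>"
  shows "real M * n ^ 3 / 100 \<le> (real (card S))\<^sup>2"
proof -
  have fin\<Lambda>: "finite \<Lambda>" using \<Lambda> fin finite_subset finite_ratios by blast
  have "real M * n / 6 * (sum r \<Lambda> - real (2 * M) * n) \<le> (real (card S))\<^sup>2"
  proof (rule cone_packing)
    fix I assume I: "I \<subseteq> \<Lambda>" "card I = 2 * M"
    have finI: "finite I" using I fin\<Lambda> finite_subset by auto
    obtain L0 where L0: "L0 \<subseteq> I" "card L0 = M" using obtain_subset_with_card_n[of M I] I by auto
    have cI: "card (I - L0) = M" using L0 I finI finite_subset by (subst card_Diff_subset) auto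
    have "sum r I = sum r (I - L0) + sum r L0" using L0 finI by (simp add: sum.subset_diff)
    \<comment> \<open>H is the heavier half, so passing from its weight to that of the block costs a
      factor 2.\<close>
    then obtain L H where LH: "L \<subseteq> I" "H \<subseteq> I" "L \<inter> H = {}" "card L = M" "card H = M" "sum r I \<le> 2 * sum r H"
      using that[of L0 "I - L0"] that[of "I - L0" L0] L0 cI by force
    have sub: "L \<subseteq> ratios A" "H \<subseteq> ratios A" "H \<subseteq> \<Lambda>" using LH I \<Lambda> by auto
    let ?Z = "(\<lambda>(l, m, c, x). (c * u l + x, l * (c * u l) + m * x)) ` (L \<times> (SIGMA m : H. A \<times> X m))"
    have "real M * real (card A) * (\<Sum>m\<in>H. real (card (X m))) / 3 \<le> real (card ?Z)"
    proof (rule crossing_block)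
      show "finite L" "finite H" using LH finI finite_subset by auto
      show "u l \<noteq> 0" if "l \<in> L" for l using that sub u_in X_pos by fastforce
      fix l m l' m' assume *: "l \<in> L" "l' \<in> L" "m \<in> H" "m' \<in> H" "(l, m) \<noteq> (l', m')"
      have "real (card (crossings A (u l) l (X m) m (u l') l' (X m') m')) \<le> n / (real M)\<^sup>2 * (r m + r m')"
        by (rule structured_crossings) (use * sub LH(3) prod rich in auto)
      then show "real (card (crossings A (u l) l (X m) m (u l') l' (X m') m')) \<le>
        real (card A) / (real M)\<^sup>2 * (real (card (X m)) + real (card (X m')))"
        by (simp add: n_def r_def)
    qed (use LH fin M in auto)
    moreover have "real M * n / 6 * sum r I \<le> real M * n / 6 * (2 * sum r H)"
      using LH n_ge by (intro mult_left_mono) auto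
    ultimately have "real M * n / 6 * sum r I \<le> real (card ?Z)" by (simp add: n_def r_def)
    moreover have uL: "u l \<in> X l" if "l \<in> L" for l using that sub u_in by blast
    moreover have "?Z \<subseteq> S \<times> S" by (auto intro: sum_point_in_S[OF _ uL])
    moreover have "in_cone I ?Z"
    proof (rule in_cone_sums)
      fix z assume "z \<in> ?Z"
      then obtain l m c x where *: "l \<in> L" "m \<in> H" "c \<in> A" "x \<in> X m"
        "z = (c * u l + x, l * (c * u l) + m * x)" by auto
      moreover have "c * u l > 0" "x > 0" using *(1-3) X_pos[OF uL] X_pos[OF *(4)] pos by simp_all
      ultimately show "\<exists>l\<in>I. \<exists>m\<in>I. \<exists>x>0. \<exists>y>0. z = (x + y, l * x + m * y)" using LH by blast
    qed
    ultimately show "\<exists>Z\<subseteq>S \<times> S. in_cone I Z \<and> real M * n / 6 * sum r I \<le> real (card Z)" by blast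
  qed (use fin\<Lambda> fin finite_AA_plus_A r_le n_ge M in auto)
  moreover have "real M * n / 6 * (n\<^sup>2 / 6) \<le> real M * n / 6 * (sum r \<Lambda> - real (2 * M) * n)"
  proof (intro mult_left_mono)
    \<comment> \<open>The weight 2 M n of an incomplete block is negligible against n^2 because n is
      at least 1024 M.\<close>
    have "1024 * real M * n \<le> n * n" using n_ge by (intro mult_right_mono) auto
    then show "n\<^sup>2 / 6 \<le> sum r \<Lambda> - real (2 * M) * n"
      using big zero_le_square[of n]
      unfolding power2_eq_square of_nat_mult of_nat_numeral by (simp only: mult.assoc)
  qed (use n_ge in auto)
  moreover have "real M * n / 6 * (n\<^sup>2 / 6) = real M * n ^ 3 / 36" by (simp add: eval_nat_numeral)
  moreover have "real M * n ^ 3 \<ge> 0" using n_ge by simp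
  ultimately show ?thesis by linarith
qed

lemma card_AA_plus_A: "real M * n ^ 3 / 100 \<le> (real (card S))\<^sup>2"
proof -
  define \<Lambda>1 where "\<Lambda>1 = {l \<in> ratios A. r l < sqrt n / real M}"
  define \<Lambda>2 where "\<Lambda>2 = {l \<in> ratios A. \<not> r l < sqrt n / real M \<and> real M * n < real (card (prodset A (X l)))}"
  define \<Lambda>3 where "\<Lambda>3 = {l \<in> ratios A. \<not> r l < sqrt n / real M \<and> \<not> real M * n < real (card (prodset A (X l)))}"
  have "n\<^sup>2 = sum r (ratios A)" using sum_slope_fibres[OF fin pos] by (simp add: n_def r_def)
  also have "ratios A = \<Lambda>1 \<union> (\<Lambda>2 \<union> \<Lambda>3)" unfolding \<Lambda>1_def \<Lambda>2_def \<Lambda>3_def by auto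
  also have "sum r (\<Lambda>1 \<union> (\<Lambda>2 \<union> \<Lambda>3)) = sum r \<Lambda>1 + (sum r \<Lambda>2 + sum r \<Lambda>3)"
    using fin by (subst sum.union_disjoint sum.union_disjoint, auto simp: \<Lambda>1_def \<Lambda>2_def \<Lambda>3_def)+
  finally consider "n\<^sup>2 / 3 \<le> sum r \<Lambda>1" | "n\<^sup>2 / 3 \<le> sum r \<Lambda>2" | "n\<^sup>2 / 3 \<le> sum r \<Lambda>3" by linarith
  then show ?thesis
  proof cases
    case 1
    then show ?thesis by (rule poor_slopes[rotated -1]) (auto simp: \<Lambda>1_def)
  next
    case 2
    then show ?thesis by (rule expanding_slopes[rotated -1]) (auto simp: \<Lambda>2_def)
  next
    case 3
    then show ?thesis by (rule structured_slopes[rotated -1]) (auto simp: \<Lambda>3_def)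
  qed
qed

end

section \<open>Choice of the block parameter and the exponent\<close>

theorem theorem4:
  shows "\<exists>(n0::int) (c::real) (C::real). c > 0 \<and> C > 0 \<and>
    (\<forall>A::real set. finite A \<and> (\<forall>a\<in>A. a > 0) \<and> int (card A) \<ge> n0 \<longrightarrow>
      real (card (AA_plus_A A)) \<ge> C * real (card A) powr (3/2 + c))"
\<comment> \<open>With t = N^(1/300) and M at least t/4, the bound M N^3 / 100 is at least t N^3 /
  400. Its square root is N^(3/2 + 1/600) / 20. The threshold 2^300 makes t at least 2, hence M
  positive.\<close>
proof (rule exI[of _ "2 ^ 300"], rule exI[of _ "1 / 600"], rule exI[of _ "1 / 20"], intro conjI allI impI)
  fix A :: "real set"
  assume A: "finite A \<and> (\<forall>a\<in>A. a > 0) \<and> int (card A) \<ge> 2 ^ 300"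
  define N where "N = real (card A)"
  have "real_of_int (2 ^ 300) \<le> real_of_int (int (card A))" using A by (simp only: of_int_le_iff)
  then have N: "2 ^ 300 \<le> N" by (simp add: N_def)
  then have np: "N > 0" by (rule less_le_trans[rotated]) simp
  define t where "t = N powr (1 / 300)"
  have t300: "t ^ 300 = N" unfolding t_def using np by (simp add: powr_power)
  have t2: "2 \<le> t"
  proof (rule ccontr)
    assume "\<not> 2 \<le> t"
    then have "t ^ 300 < 2 ^ 300" by (intro power_strict_mono) (auto simp: t_def)
    then show False using N t300 by simp
  qed
  define M where "M = nat \<lfloor>t / 2\<rfloor>"
  have "1 \<le> \<lfloor>t / 2\<rfloor>" using t2 by simp
  then have Mt: "M > 0" "2 * real M \<le> t" "t / 4 \<le> real M" using t2 unfolding M_def by linarith+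
  have "(2 * real M) ^ 300 \<le> t ^ 300" using Mt by (intro power_mono) auto
  then have "real ((2 * M) ^ 300) \<le> real (card A)" unfolding t300 by (simp add: N_def)
  then have "(2 * M) ^ 300 \<le> card A" by (simp only: of_nat_le_iff)
  then interpret large_positive_set A M using A Mt by unfold_locales auto
  have "t / 4 * N ^ 3 / 100 \<le> real M * N ^ 3 / 100" using Mt np by (intro divide_right_mono mult_right_mono) auto
  also have "\<dots> \<le> (real (card S))\<^sup>2" using card_AA_plus_A by (simp add: n_def N_def)
  also have "t / 4 * N ^ 3 / 100 = (1 / 20 * N powr (3 / 2 + 1 / 600))\<^sup>2"
  proof -
    have "(N powr (3 / 2 + 1 / 600))\<^sup>2 = N powr (3 + 1 / 300)"
      using np by (simp add: powr_power)
    also have "\<dots> = N powr 3 * t" by (simp only: powr_add t_def)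
    also have "N powr 3 = N ^ 3" using np by simp
    finally show ?thesis by (simp add: power_mult_distrib power_divide)
  qed
  finally have "1 / 20 * N powr (3 / 2 + 1 / 600) \<le> real (card S)" by (rule power2_le_imp_le) simp
  then show "1 / 20 * real (card A) powr (3 / 2 + 1 / 600) \<le> real (card S)" by (simp only: N_def)
qed auto

end
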